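(* Let $1\le r\le n$ and $M\ge 1$ be integers, let $\boldsymbol{\gamma}=(\gamma_1,\dots,\gamma_r)\in(0,\infty)^r$ with $\gamma_1=n$, and let $F\in\mathcal{F}$. Let $\boldsymbol{X}_i=(X_i^{(1)},\dots,X_i^{(r)})$, $1\le i\le M$, be iid random vectors, each distributed as the first $r$ sequential order statistics based on $F$ and $\boldsymbol{\gamma}$, and let $\mathbf{X}=(X_i^{(j)})_{1\le i\le M,1\le j\le r}$. Then the profile likelihood estimator $\hat{\boldsymbol{\gamma}}^{\mathrm{PL}}=\arg\max_{\boldsymbol{g}}L(\boldsymbol{g},\mathbf{X})$ is distribution-free with respect to the baseline cdf $F\in\mathcal{F}$; that is, for fixed $n,r,M$ and $\boldsymbol{\gamma}$, the distribution of $\hat{\boldsymbol{\gamma}}^{\mathrm{PL}}$ is the same for all $F\in\mathcal{F}$.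
   Context: $\mathcal{F}$ is the class of all absolutely continuous cumulative distribution functions (cdfs) $F$ with $F(0)=0$. For $F\in\mathcal{F}$, $\lambda_F(t)=-\frac{d}{dt}\ln(1-F(t))$ is the hazard rate. Sequential order statistics (SOSs). Let $1\le r\le n$ and let $\boldsymbol{\gamma}=(\gamma_1,\dots,\gamma_r)\in(0,\infty)^r$; one writes $\gamma_k=(n-k+1)\alpha_k$ with load-sharing parameters $\alpha_k>0$, and it is assumed throughout that $\alpha_1=1$, i.e. $\gamma_1=n$. Set $\gamma_{r+1}=0$. Increasingly ordered random variables $X^{(1)}\le\dots\le X^{(r)}$ are distributed as the first $r$ SOSs based on $F\in\mathcal{F}$ and $\boldsymbol{\gamma}$ if the counting process $N(t)=\sum_{j=1}^r\mathbf{1}_{\{X^{(j)}\le t\}}$, $t\ge 0$, has cumulative intensity process (compensator with respect to its natural filtration) $\Lambda(t)=\int_0^t\lambda_F(s)\,\gamma_{N(s-)+1}\,ds$, $t\ge0$. Profile likelihood. For the data matrix $\mathbf{X}$ let $N_k(t)=\sum_{l=1}^r\mathbf{1}_{\{X_k^{(l)}\le t\}}$, so $N_k(t-)=\sum_{l=1}^r\mathbf{1}_{\{X_k^{(l)}<t\}}$. For $\boldsymbol{g}=(g_1,\dots,g_r)\in(0,\infty)^r$ with $g_1=n$, and with $g_{r+1}:=0$, $$L(\boldsymbol{g},\mathbf{X})=\prod_{i=1}^M\prod_{j=1}^r\frac{g_j}{\sum_{k=1}^M g_{N_k(X_i^{(j)}-)+1}}.$$ The maximum defining $\hat{\boldsymbol{\gamma}}^{\mathrm{PL}}$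 is taken over all $\boldsymbol{g}\in(0,\infty)^r$ with $g_1=n$. *)

theory Defs
  imports "HOL-Probability.Probability"
begin

section \<open>Baseline distributions\<close>

definition abs_cont_lifetime_cdf :: "(real \<Rightarrow> real) \<Rightarrow> bool" where
  "abs_cont_lifetime_cdf F \<longleftrightarrow>
     (\<exists>\<mu>. real_distribution \<mu> \<and> absolutely_continuous lborel \<mu> \<and> F = cdf \<mu>) \<and> F 0 = 0"

text \<open>Only the values at almost every \<open>t\<close> matter below. In particular the derivative need not
  exist on a null set, and since \<open>ln 0 = 0\<close> the value to the right of the support of \<open>F\<close> is \<open>0\<close>.\<close>

definition hazard_rate :: "(real \<Rightarrow> real) \<Rightarrow> real \<Rightarrow> real" where
  "hazard_rate F t = - deriv (\<lambda>s. ln (1 - F s)) t"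

section \<open>Counting processes and their compensators\<close>

text \<open>Processes have time set \<open>[0, \<infinity>)\<close>; their values at negative times are irrelevant.
  The last clause below says that the (integer-valued, nondecreasing) path has jumps of size one:
  \<open>N t\<close> exceeds its left limit by at most \<open>1\<close>.\<close>

definition counting_path :: "(real \<Rightarrow> nat) \<Rightarrow> bool" where
  "counting_path N \<longleftrightarrow>
     N 0 = 0 \<and> mono_on {0..} N \<and> (\<forall>t\<ge>0. continuous (at_right t) N) \<and>
     (\<forall>t>0. \<exists>s\<in>{0..<t}. N t \<le> N s + 1)"

definition counting_process :: "'a measure \<Rightarrow> (real \<Rightarrow> 'a \<Rightarrow> nat) \<Rightarrow> bool" where
  "counting_process P N \<longleftrightarrow>
     (\<forall>t\<ge>0. N t \<in> P \<rightarrow>\<^sub>M count_space UNIV) \<and>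
     (AE \<omega> in P. counting_path (\<lambda>t. N t \<omega>))"

definition natural_filtration :: "'a measure \<Rightarrow> (real \<Rightarrow> 'a \<Rightarrow> nat) \<Rightarrow> real \<Rightarrow> 'a measure" where
  "natural_filtration P N t =
     sigma (space P) {N s -` B \<inter> space P | s B. s \<in> {0..t}}"

definition predictable_sigma :: "'a measure \<Rightarrow> (real \<Rightarrow> 'a measure) \<Rightarrow> (real \<times> 'a) measure" where
  "predictable_sigma P Fil =
     sigma ({0..} \<times> space P)
       ({{0} \<times> A | A. A \<in> sets (Fil 0)} \<union>
        {{s<..t} \<times> A | s t A. 0 \<le> s \<and> s \<le> t \<and> A \<in> sets (Fil s)})"

definition martingale :: "'a measure \<Rightarrow> (real \<Rightarrow> 'a measure) \<Rightarrow> (real \<Rightarrow> 'a \<Rightarrow> real) \<Rightarrow> bool" where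
  "martingale P Fil Z \<longleftrightarrow>
     (\<forall>t\<ge>0. Z t \<in> borel_measurable (Fil t) \<and> integrable P (Z t)) \<and>
     (\<forall>s t. 0 \<le> s \<and> s \<le> t \<longrightarrow> (AE \<omega> in P. real_cond_exp P (Fil s) (Z t) \<omega> = Z s \<omega>))"

text \<open>A candidate compensator is allowed to be \<open>\<infinity>\<close> on a null set, hence the values in \<open>ennreal\<close>.
  The definition is meant for counting processes that are bounded (so that \<open>N - A\<close> is a
  martingale, not merely a local one).\<close>

definition compensator ::
    "'a measure \<Rightarrow> (real \<Rightarrow> 'a measure) \<Rightarrow> (real \<Rightarrow> 'a \<Rightarrow> nat) \<Rightarrow> (real \<Rightarrow> 'a \<Rightarrow> ennreal) \<Rightarrow> bool" where
  "compensator P Fil N A \<longleftrightarrow>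
     (AE \<omega> in P. A 0 \<omega> = 0 \<and> mono_on {0..} (\<lambda>t. A t \<omega>) \<and>
        (\<forall>t\<ge>0. continuous (at_right t) (\<lambda>s. A s \<omega>) \<and> A t \<omega> < \<infinity>)) \<and>
     (\<lambda>(t, \<omega>). A t \<omega>) \<in> borel_measurable (predictable_sigma P Fil) \<and>
     martingale P Fil (\<lambda>t \<omega>. real (N t \<omega>) - enn2real (A t \<omega>))"

section \<open>Sequential order statistics\<close>

text \<open>Vectors in \<open>\<real>\<^sup>r\<close> are extensional functions on \<open>{1..r}\<close>.\<close>

abbreviation vec_borel :: "nat \<Rightarrow> (nat \<Rightarrow> real) measure" where
  "vec_borel r \<equiv> PiM {1..r} (\<lambda>_. borel)"

definition ext0 :: "nat \<Rightarrow> (nat \<Rightarrow> real) \<Rightarrow> nat \<Rightarrow> real" where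
  "ext0 r g j = (if j \<in> {1..r} then g j else 0)"

definition count_upto :: "nat \<Rightarrow> (nat \<Rightarrow> real) \<Rightarrow> real \<Rightarrow> nat" where
  "count_upto r x t = (\<Sum>l = 1..r. if x l \<le> t then 1 else 0)"

definition count_before :: "nat \<Rightarrow> (nat \<Rightarrow> real) \<Rightarrow> real \<Rightarrow> nat" where
  "count_before r x t = (\<Sum>l = 1..r. if x l < t then 1 else 0)"

definition cumulative_intensity ::
    "nat \<Rightarrow> (nat \<Rightarrow> real) \<Rightarrow> (real \<Rightarrow> real) \<Rightarrow> (nat \<Rightarrow> real) \<Rightarrow> real \<Rightarrow> ennreal" where
  "cumulative_intensity r \<gamma> F x t =
     (\<integral>\<^sup>+ s \<in> {0..t}. ennreal (hazard_rate F s * ext0 r \<gamma> (count_before r x s + 1)) \<partial>lborel)"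

definition sequential_order_statistics ::
    "'a measure \<Rightarrow> nat \<Rightarrow> (nat \<Rightarrow> real) \<Rightarrow> (real \<Rightarrow> real) \<Rightarrow> ('a \<Rightarrow> nat \<Rightarrow> real) \<Rightarrow> bool" where
  "sequential_order_statistics P r \<gamma> F X \<longleftrightarrow>
     X \<in> P \<rightarrow>\<^sub>M vec_borel r \<and>
     (AE \<omega> in P. mono_on {1..r} (X \<omega>)) \<and>
     (let N = (\<lambda>t \<omega>. count_upto r (X \<omega>) t) in
        counting_process P N \<and>
        compensator P (natural_filtration P N) N
          (\<lambda>t \<omega>. cumulative_intensity r \<gamma> F (X \<omega>) t))"

definition iid_sos_sample ::
    "'a measure \<Rightarrow> nat \<Rightarrow> nat \<Rightarrow> (nat \<Rightarrow> real) \<Rightarrow> (real \<Rightarrow> real) \<Rightarrow> (nat \<Rightarrow> 'a \<Rightarrow> nat \<Rightarrow> real) \<Rightarrow> bool" where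
  "iid_sos_sample P M r \<gamma> F X \<longleftrightarrow>
     prob_space.indep_vars P (\<lambda>_. vec_borel r) X {1..M} \<and>
     (\<forall>i\<in>{1..M}. \<forall>k\<in>{1..M}. distr P (vec_borel r) (X i) = distr P (vec_borel r) (X k)) \<and>
     (\<forall>i\<in>{1..M}. sequential_order_statistics P r \<gamma> F (X i))"

section \<open>Profile likelihood estimation\<close>

text \<open>The data matrix \<open>x\<close> has entries \<open>x i j\<close> with \<open>i \<in> {1..M}\<close>, \<open>j \<in> {1..r}\<close>.\<close>

definition profile_likelihood ::
    "nat \<Rightarrow> nat \<Rightarrow> (nat \<Rightarrow> real) \<Rightarrow> (nat \<Rightarrow> nat \<Rightarrow> real) \<Rightarrow> real" where
  "profile_likelihood M r g x =
     (\<Prod>i = 1..M. \<Prod>j = 1..r.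
        g j / (\<Sum>k = 1..M. ext0 r g (count_before r (x k) (x i j) + 1)))"

definition pl_params :: "nat \<Rightarrow> nat \<Rightarrow> (nat \<Rightarrow> real) set" where
  "pl_params n r = {g \<in> PiE {1..r} (\<lambda>_. {0<..}). g 1 = real n}"

definition pl_argmax :: "nat \<Rightarrow> nat \<Rightarrow> nat \<Rightarrow> (nat \<Rightarrow> nat \<Rightarrow> real) \<Rightarrow> (nat \<Rightarrow> real) set" where
  "pl_argmax n r M x =
     {g. is_arg_max (\<lambda>g. profile_likelihood M r g x) (\<lambda>g. g \<in> pl_params n r) g}"

text \<open>Depending on the data, the maximizer may fail to be unique (for \<open>M = 1\<close> the likelihood is
  constant) or to exist (for \<open>M = r = 2\<close>, if both observations of one row precede those of the
  other row). The estimator is therefore determined by the set of maximizers together with a convention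
  \<open>sel\<close>, which breaks ties and assigns some vector to the empty set.\<close>

definition argmax_selection :: "nat \<Rightarrow> nat \<Rightarrow> ((nat \<Rightarrow> real) set \<Rightarrow> nat \<Rightarrow> real) \<Rightarrow> bool" where
  "argmax_selection n r sel \<longleftrightarrow>
     (\<forall>A. A \<subseteq> pl_params n r \<and> A \<noteq> {} \<longrightarrow> sel A \<in> A) \<and> sel {} \<in> space (vec_borel r)"

definition pl_estimator ::
    "((nat \<Rightarrow> real) set \<Rightarrow> nat \<Rightarrow> real) \<Rightarrow> nat \<Rightarrow> nat \<Rightarrow> nat \<Rightarrow> (nat \<Rightarrow> nat \<Rightarrow> real) \<Rightarrow> nat \<Rightarrow> real" where
  "pl_estimator sel n r M x = sel (pl_argmax n r M x)"

section \<open>Equality in distribution\<close>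

text \<open>Measurability is part of the notion, since \<open>distr\<close> is only meaningful for measurable maps.\<close>

definition equal_in_distribution ::
    "'c measure \<Rightarrow> 'a measure \<Rightarrow> ('a \<Rightarrow> 'c) \<Rightarrow> 'b measure \<Rightarrow> ('b \<Rightarrow> 'c) \<Rightarrow> bool" where
  "equal_in_distribution S P U Q V \<longleftrightarrow>
     U \<in> P \<rightarrow>\<^sub>M S \<and> V \<in> Q \<rightarrow>\<^sub>M S \<and> distr P S U = distr Q S V"

end

theory Submission
  imports Defs
begin

text \<open>
  Put \<open>R j = (1 - F (X j)) / (1 - F (X (j - 1)))\<close>, where \<open>F (X 0)\<close> is read as \<open>0\<close>. Testing the compensator
  identity against predictable integrands shows that, given the earlier observations, \<open>R j\<close> has
  distribution function \<open>w powr \<gamma> j\<close> on \<open>[0, 1]\<close>. So the joint law of the ratios does not involve \<open>F\<close>, and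
  neither does that of the transformed data, as \<open>1 - F (X j)\<close> is the product of \<open>R 1, \<dots>, R j\<close>. The profile
  likelihood depends on the data only through their relative order. Almost surely no observation lies
  in a flat piece of \<open>F\<close>, because the hazard rate vanishes there; so applying \<open>F\<close> to all data keeps
  the order, and the maximizers computed from \<open>X\<close> and from \<open>F (X)\<close> agree.
\<close>

section \<open>Absolutely continuous lifetime distributions\<close>

text \<open>The data are described only through a compensator, not through a density, and
  \<open>F\<close> may have flat pieces, points without derivative and a finite right endpoint. Two
  devices cope with this. The hazard rate is traded for the measure with cdf \<open>F\<close>: it
  equals the density divided by \<open>1 - F\<close> almost everywhere, so integrals run against
  \<open>\<mu>\<close>, and the substitution \<open>u = F s\<close> carries them to Lebesgue measure
  on [0, 1]. And no general theorem that a compensator determines the law is invoked. In the time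
  scale \<open>- ln (1 - F s)\<close> the intensity between observations \<open>j - 1\<close> and
  \<open>j\<close> is the constant \<open>\<gamma> j\<close>, so \<open>- ln (R j)\<close> ought to
  be exponential with that parameter. To confirm this, one integrand is chosen for each threshold
  \<open>w\<close> such that its jump part minus its compensator part is a constant minus a multiple
  of the indicator of \<open>R j \<le> w\<close>; the vanishing mean is then the distribution
  function itself, and no functional or differential equation has to be solved.\<close>

lemma cdf_has_derivative_AE:
  fixes f :: "real \<Rightarrow> real"
  assumes \<mu>: "real_distribution \<mu>" and f[measurable]: "f \<in> borel_measurable borel"
    and f0: "\<And>x. 0 \<le> f x" and dens: "\<mu> = density lborel (\<lambda>x. ennreal (f x))"
  shows "AE x in lborel. (cdf \<mu> has_real_derivative f x) (at x)"
proof -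
  interpret real_distribution \<mu> by fact
  have em: "emeasure \<mu> S = (\<integral>\<^sup>+x\<in>S. f x \<partial>lborel)" if "S \<in> sets borel" for S
    using that by (simp add: dens emeasure_density)
  have intf: "integrable lborel f"
    using em[of UNIV] emeasure_space_1 f0 by (intro integrableI_nonneg) auto
  have int_on: "f integrable_on S" "set_integrable lborel S f" if "S \<in> sets borel" for S
  proof -
    show *: "set_integrable lborel S f"
      unfolding set_integrable_def using that intf by (intro integrable_mult_indicator) auto
    show "f integrable_on S"
      by (rule set_borel_integral_eq_integral(1)[OF *])
  qed
  have incr: "integral {a..b} f = cdf \<mu> b - cdf \<mu> a" if "a \<le> b" for a b
  proof -
    have "ennreal (integral {a..b} f) = (\<integral>\<^sup>+x\<in>{a..b}. f x \<partial>lborel)"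
      using set_borel_integral_eq_integral(2)[OF int_on(2), of "{a..b}"] intf f0
      by (simp add: nn_set_integral_eq_set_integral)
    also have "\<dots> = (\<integral>\<^sup>+x\<in>{a<..b}. f x \<partial>lborel)"
      using AE_lborel_singleton[of a]
      by (intro nn_integral_cong_AE, eventually_elim) (auto split: split_indicator)
    also have "\<dots> = emeasure \<mu> {a<..b}"
      by (simp add: em)
    finally show ?thesis
      using that integral_nonneg[of f "{a..b}"] f0 int_on(1)[of "{a..b}"] cdf_diff_eq[of a b]
      by (cases "a = b") (auto simp: emeasure_eq_measure)
  qed
  \<comment> \<open>The differentiation theorem \<open>integrable_ccontinuous_explicit\<close>
    averages only over intervals to the right of \<open>x\<close>. Left difference quotients come
    from applying it to the reflected density at \<open>- x\<close>.\<close>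
  have incr': "integral {a..b} (\<lambda>x. f (- x)) = cdf \<mu> (- a) - cdf \<mu> (- b)" if "a \<le> b" for a b
    using incr[of "- b" "- a"] that Henstock_Kurzweil_Integration.integral_reflect_real[of "- a" "- b" f] by simp
  obtain N1 where N1: "negligible N1"
    "\<And>x e. \<lbrakk>x \<notin> N1; 0 < e\<rbrakk> \<Longrightarrow> \<exists>d>0. \<forall>h. 0 < h \<and> h < d \<longrightarrow>
        norm (integral (cbox x (x + h *\<^sub>R One)) f /\<^sub>R h ^ DIM(real) - f x) < e"
    by (rule integrable_ccontinuous_explicit[of f, OF int_on(1)[OF borel_closed[OF closed_cbox]]])
      (rule that, assumption, blast)
  have int_refl: "(\<lambda>x. f (- x)) integrable_on cbox a b" for a b
    using int_on(1)[of "{-b..-a}"] Henstock_Kurzweil_Integration.integrable_reflect_real[of f "-a" "-b"]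
    by simp
  obtain N2 where N2: "negligible N2"
    "\<And>x e. \<lbrakk>x \<notin> N2; 0 < e\<rbrakk> \<Longrightarrow> \<exists>d>0. \<forall>h. 0 < h \<and> h < d \<longrightarrow>
        norm (integral (cbox x (x + h *\<^sub>R One)) (\<lambda>x. f (- x)) /\<^sub>R h ^ DIM(real) - f (- x)) < e"
    by (rule integrable_ccontinuous_explicit[of "\<lambda>x. f (- x)", OF int_refl])
      (rule that, assumption, blast)
  have deriv: "(cdf \<mu> has_real_derivative f x) (at x)" if x: "x \<notin> N1" "- x \<notin> N2" for x
    unfolding has_field_derivative_def[symmetric] DERIV_def LIM_eq
  proof (intro allI impI)
    fix e :: real assume e: "0 < e"
    obtain d1 where d1: "d1 > 0" "\<And>h. 0 < h \<Longrightarrow> h < d1 \<Longrightarrow> \<bar>(cdf \<mu> (x + h) - cdf \<mu> x) / h - f x\<bar> < e"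
      using N1(2)[OF x(1) e] incr[of x "x + _"] by (auto simp: divide_inverse_commute)
    obtain d2 where d2: "d2 > 0" "\<And>h. 0 < h \<Longrightarrow> h < d2 \<Longrightarrow> \<bar>(cdf \<mu> x - cdf \<mu> (x - h)) / h - f x\<bar> < e"
      using N2(2)[OF x(2) e] incr'[of "- x" "- x + _"] by (auto simp: divide_inverse_commute)
    show "\<exists>s>0. \<forall>h. h \<noteq> 0 \<and> norm (h - 0) < s \<longrightarrow> norm ((cdf \<mu> (x + h) - cdf \<mu> x) / h - f x) < e"
    proof (intro exI[of _ "min d1 d2"] conjI allI impI)
      fix h :: real assume h: "h \<noteq> 0 \<and> norm (h - 0) < min d1 d2"
      show "norm ((cdf \<mu> (x + h) - cdf \<mu> x) / h - f x) < e"
      proof (cases "h > 0")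
        case True then show ?thesis using d1(2)[of h] h by auto
      next
        case False
        then have "(cdf \<mu> (x + h) - cdf \<mu> x) / h = (cdf \<mu> x - cdf \<mu> (x - (- h))) / (- h)"
          by (metis add_uminus_conv_diff minus_diff_eq minus_divide_divide minus_minus)
        then show ?thesis using d2(2)[of "- h"] h False by auto
      qed
    qed (use d1 d2 in auto)
  qed
  have "negligible (uminus ` N2)"
    using N2(1) by (intro negligible_differentiable_image_negligible) (auto simp: differentiable_on_def)
  then have "AE x in lebesgue. x \<notin> N1 \<and> x \<notin> uminus ` N2"
    using N1(1) by (auto simp: negligible_iff_null_sets intro!: AE_conjI AE_not_in)
  then have "AE x in lborel. x \<notin> N1 \<and> x \<notin> uminus ` N2"
    by (simp add: AE_completion_iff)
  then show ?thesis
    by eventually_elim (use deriv in \<open>force simp: image_iff\<close>)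
qed

locale ac_lifetime = real_distribution \<mu> for \<mu> :: "real measure" +
  assumes ac: "absolutely_continuous lborel \<mu>"
    and cdf_0: "cdf \<mu> 0 = 0"
begin

abbreviation F :: "real \<Rightarrow> real" where "F \<equiv> cdf \<mu>"

lemma emeasure_singleton [simp]: "emeasure \<mu> {x} = 0"
  using ac[unfolded absolutely_continuous_def, THEN subsetD, of "{x}"] by (auto simp: null_sets_def)

lemma F_mono: "x \<le> y \<Longrightarrow> F x \<le> F y"
  by (rule cdf_nondecreasing)

lemma F_le_1: "F x \<le> 1"
  by (rule cdf_bounded_prob)

lemma F_borel [measurable]: "F \<in> borel_measurable borel"
  using F_mono by (intro borel_measurable_mono) (auto simp: mono_def)

lemma AE_pos: "AE s in \<mu>. 0 < s"
proof -
  have "emeasure \<mu> {..0} = 0"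
    using cdf_0 by (simp add: emeasure_eq_measure cdf_def)
  then show ?thesis
    by (subst AE_iff_measurable[OF _ refl]) (auto simp: not_less atMost_def)
qed

lemma isCont_F: "isCont F x"
  by (simp add: isCont_cdf measure_def)

text \<open>By \<open>ln 0 = 0\<close>; since division by \<open>0\<close> also gives \<open>0\<close>, the hazard rate is \<open>density / survival\<close> beyond the
  support of \<open>F\<close> as well.\<close>

lemma hazard_rate_zero_AE:
  "AE s in lborel. F s = 1 \<longrightarrow> hazard_rate F s = 0"
proof -
  \<comment> \<open>Every other point of the level set has \<open>F = 1\<close> on a whole
    neighbourhood, so only this left endpoint has to be discarded.\<close>
  define b where "b = Inf {s. F s = 1}"
  have "hazard_rate F s = 0" if s: "s \<noteq> b" "F s = 1" for s
  proof -
    have "\<exists>q<s. F q = 1"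
    proof (rule ccontr)
      assume "\<not> ?thesis"
      then have "b = s"
        unfolding b_def using s(2) by (intro cInf_eq_minimum) (auto simp: not_less[symmetric])
      with s show False by simp
    qed
    then obtain q where q: "q < s" "F q = 1" by blast
    have *: "F x = 1" if "x \<in> {q<..}" for x
      using that q F_mono[of q x] F_le_1[of x] by auto
    have "((\<lambda>x. 0) has_real_derivative 0) (at s)" by simp
    then have "((\<lambda>x. ln (1 - F x)) has_real_derivative 0) (at s)"
      by (rule has_field_derivative_transform_within_open[of _ _ _ "{q<..}"]) (use q * in auto)
    then show ?thesis
      unfolding hazard_rate_def by (simp add: DERIV_imp_deriv)
  qed
  then show ?thesis
    using AE_lborel_singleton[of b] by auto
qed

text \<open>Hazard rate times Lebesgue measure is \<open>1 / (1 - F)\<close> times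
  \<open>\<mu>\<close>. The cumulative intensity is rewritten by this once, and derivatives of
  \<open>F\<close> do not occur afterwards.\<close>

lemma nn_integral_hazard:
  assumes c[measurable]: "c \<in> borel_measurable borel" and c0: "\<And>s. 0 \<le> c s" and S[measurable]: "S \<in> sets borel"
  shows "(\<integral>\<^sup>+s\<in>S. ennreal (hazard_rate F s * c s) \<partial>lborel) = (\<integral>\<^sup>+s\<in>S. ennreal (c s / (1 - F s)) \<partial>\<mu>)"
proof -
  obtain f where f[measurable]: "f \<in> borel_measurable borel" and f0: "\<And>x. 0 \<le> f x"
    and dens: "\<mu> = density lborel (\<lambda>x. ennreal (f x))"
  proof -
    obtain D where D: "D \<in> borel_measurable lborel" "AE x in lborel. RN_deriv lborel \<mu> x = ennreal (D x)"
        "\<And>x. 0 \<le> D x"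
      using sigma_finite_measure.real_RN_deriv[OF lborel.sigma_finite_measure_axioms finite_measure_axioms ac]
      by auto
    have "density lborel (RN_deriv lborel \<mu>) = \<mu>"
      using ac by (intro sigma_finite_measure.density_RN_deriv lborel.sigma_finite_measure_axioms) auto
    also have "density lborel (RN_deriv lborel \<mu>) = density lborel (\<lambda>x. ennreal (D x))"
      using D by (intro density_cong) auto
    finally show ?thesis
      using D that by auto
  qed
  have "AE s in lborel. hazard_rate F s = f s / (1 - F s)"
    using cdf_has_derivative_AE[OF real_distribution_axioms f f0 dens] hazard_rate_zero_AE
  proof eventually_elim
    case (elim s)
    show ?case
    proof (cases "F s = 1")
      case False
      then have "((\<lambda>x. ln (1 - F x)) has_real_derivative (- f s / (1 - F s))) (at s)"
        using F_le_1[of s] by (auto intro!: derivative_eq_intros elim(1))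
      then show ?thesis
        unfolding hazard_rate_def by (simp add: DERIV_imp_deriv)
    qed (use elim in simp)
  qed
  then have "(\<integral>\<^sup>+s\<in>S. ennreal (hazard_rate F s * c s) \<partial>lborel)
    = (\<integral>\<^sup>+s. ennreal (f s) * (ennreal (c s / (1 - F s)) * indicator S s) \<partial>lborel)"
    by (intro nn_integral_cong_AE, eventually_elim)
       (use F_le_1 f0 c0 in \<open>auto simp: ennreal_mult' [symmetric] split: split_indicator\<close>)
  also have "\<dots> = (\<integral>\<^sup>+s\<in>S. ennreal (c s / (1 - F s)) \<partial>\<mu>)"
    by (subst nn_integral_density[symmetric]) (simp_all add: dens[symmetric])
  finally show ?thesis .
qed

section \<open>Probability integral transform\<close>

lemma F_attains:
  assumes "0 < u" "u < 1"
  obtains b where "F b = u"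
proof -
  obtain a where a: "F a < u"
    using order_tendstoD(2)[OF cdf_lim_at_bot assms(1)] by (auto simp: eventually_at_bot_linorder)
  obtain c where c: "u < F c"
    using order_tendstoD(1)[OF cdf_lim_at_top_prob assms(2)] by (auto simp: eventually_at_top_linorder)
  have "a \<le> c"
    using F_mono[of c a] a c by (cases "a \<le> c") auto
  then show ?thesis
    using IVT[of F a u c] a c isCont_F that by auto
qed

lemma prob_F_le:
  assumes u: "0 \<le> u" "u \<le> 1"
  shows "prob {s. F s \<le> u} = u"
proof (cases "u = 1")
  case False
  \<comment> \<open>\<open>F\<close> may stay at the level \<open>u\<close> for a while, so a point
    with \<open>F b = u\<close> need not bound the set. A point at a slightly higher level
    \<open>v\<close> does.\<close>
  have "prob {s. F s \<le> u} \<le> v" if v: "u < v" "v < 1" for v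
  proof -
    obtain b where b: "F b = v"
      using F_attains[of v] u v by auto
    have "prob {s. F s \<le> u} \<le> prob {..b}"
    proof (rule finite_measure_mono)
      show "{s. F s \<le> u} \<subseteq> {..b}"
      proof clarify
        fix s assume "F s \<le> u"
        then show "s \<le> b"
          using b v F_mono[of b s] by linarith
      qed
    qed simp
    then show ?thesis
      using b by (simp add: cdf_def)
  qed
  then have "prob {s. F s \<le> u} \<le> u"
    using u False by (intro dense_ge_bounded[of u 1]) auto
  moreover have "u \<le> prob {s. F s \<le> u}"
  proof (cases "u = 0")
    case F: False
    then obtain b where b: "F b = u"
      using F_attains[of u] u False by auto
    have "prob {..b} \<le> prob {s. F s \<le> u}"
      using b F_mono[of _ b] by (intro finite_measure_mono) auto
    then show ?thesis
      using b by (simp add: cdf_def)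
  qed simp
  ultimately show ?thesis by simp
qed (use F_le_1 prob_space in simp)

lemma distr_F: "distr \<mu> borel F = density lborel (indicator {0..1})"
proof (rule measure_eqI_lessThan)
  fix x :: real
  have eq: "emeasure (distr \<mu> borel F) {x<..} = ennreal (1 - prob {s. F s \<le> x})"
  proof -
    have "emeasure (distr \<mu> borel F) {x<..} = prob (space \<mu> - {s. F s \<le> x})"
      by (subst emeasure_distr) (auto simp: emeasure_eq_measure intro!: arg_cong[of _ _ prob])
    then show ?thesis
      by (subst (asm) prob_compl) auto
  qed
  then show "emeasure (distr \<mu> borel F) {x<..} < \<infinity>" by simp
  have "emeasure (density lborel (indicator {0..1})) {x<..} = emeasure lborel ({0..1} \<inter> {x<..})"
    by (subst emeasure_density) (auto simp: indicator_inter_arith[symmetric])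
  also have "\<dots> = ennreal (1 - prob {s. F s \<le> x})"
  proof -
    consider "x < 0" | "0 \<le> x" "x \<le> 1" | "1 < x" by linarith
    then show ?thesis
    proof cases
      case 1
      then have "{s. F s \<le> x} = {}"
        using cdf_nonneg by (auto simp: not_le intro: less_le_trans)
      moreover have "{0..1} \<inter> {x<..} = {0..1}" using 1 by auto
      ultimately show ?thesis by simp
    next
      case 2
      have "{0..1} \<inter> {x<..} = {x<..1}" using 2 by auto
      with 2 show ?thesis by (simp add: prob_F_le)
    next
      case 3
      then have "{s. F s \<le> x} = UNIV"
        using F_le_1 by (auto intro: order_trans less_imp_le)
      moreover have "{0..1} \<inter> {x<..} = {}" using 3 by auto
      ultimately show ?thesis using prob_space by simp
    qed
  qed
  finally show "emeasure (distr \<mu> borel F) {x<..} = emeasure (density lborel (indicator {0..1})) {x<..}"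
    by (simp add: eq)
qed auto

lemma nn_integral_cdf_transform:
  assumes [measurable]: "g \<in> borel_measurable borel"
  shows "(\<integral>\<^sup>+s. g (F s) \<partial>\<mu>) = (\<integral>\<^sup>+u\<in>{0..1}. g u \<partial>lborel)"
proof -
  have "(\<integral>\<^sup>+s. g (F s) \<partial>\<mu>) = (\<integral>\<^sup>+u. g u \<partial>distr \<mu> borel F)"
    by (subst nn_integral_distr) auto
  also have "\<dots> = (\<integral>\<^sup>+u\<in>{0..1}. g u \<partial>lborel)"
    unfolding distr_F by (subst nn_integral_density) (auto simp: mult.commute)
  finally show ?thesis .
qed

text \<open>\<open>F\<close> maps \<open>\<mu>\<close> to the uniform law, which has no atoms. So
  each flat piece of \<open>F\<close> is a null set of \<open>\<mu>\<close>, however long it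
  is.\<close>

lemma F_neq_AE: "AE s in \<mu>. F s \<noteq> c"
proof -
  have "emeasure \<mu> {s. F s = c} = (\<integral>\<^sup>+s. indicator {s. F s = c} s \<partial>\<mu>)"
    by simp
  also have "\<dots> = (\<integral>\<^sup>+s. indicator {c} (F s) \<partial>\<mu>)"
    by (intro nn_integral_cong) (simp add: indicator_def)
  also have "\<dots> = (\<integral>\<^sup>+u\<in>{0..1}. indicator {c} u \<partial>lborel)"
    by (rule nn_integral_cdf_transform) simp
  also have "\<dots> = 0"
    by (subst nn_integral_0_iff_AE, simp, rule eventually_mono[OF AE_lborel_singleton[of c]]) simp
  finally show ?thesis
    by (subst AE_iff_measurable[OF _ refl]) auto
qed

text \<open>To be used with \<open>p\<close> and \<open>x\<close> two successive observations. After
  \<open>u = F s\<close> the integrand is the derivative of \<open>(q / (1 - u)) powr c\<close>,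
  which is 1 at the left endpoint. The condition involving \<open>w\<close> merely moves the right
  endpoint from \<open>F x\<close> to \<open>v\<close>, and this is where the maximum comes
  from.\<close>

lemma nn_integral_ratio_window:
  assumes px: "p \<le> x" and Fx: "F x < 1" and w: "0 < w" "w \<le> 1" and c: "0 < c"
  shows "(\<integral>\<^sup>+s\<in>{p<..x}. ennreal (if w * (1 - F p) < 1 - F s then c / (1 - F s) * ((1 - F p) / (1 - F s)) powr c else 0) \<partial>\<mu>)
    = ennreal (max ((1 - F x) / (1 - F p)) w powr (- c) - 1)"
proof -
  define q where "q = 1 - F p"
  define v where "v = min (F x) (1 - w * q)"
  have Fpx: "F p \<le> F x" using px by (rule F_mono)
  then have q: "0 < q" "q \<le> 1" using Fx cdf_nonneg[of p] by (auto simp: q_def)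
  have wq: "0 < w * q" "w * q \<le> q"
    using w q by (auto intro: mult_left_le_one_le)
  have v: "F p \<le> v" "v < 1" using Fpx Fx wq unfolding v_def q_def by linarith+
  define g where "g u = c / (1 - u) * (q / (1 - u)) powr c" for u
  have [measurable]: "g \<in> borel_measurable borel" unfolding g_def by measurable
  have "(\<integral>\<^sup>+s\<in>{p<..x}. ennreal (if w * q < 1 - F s then g (F s) else 0) \<partial>\<mu>)
      = (\<integral>\<^sup>+s. ennreal (g (F s)) * indicator {F p..v} (F s) \<partial>\<mu>)"
  proof (intro nn_integral_cong_AE)
    show "AE s in \<mu>. ennreal (if w * q < 1 - F s then g (F s) else 0) * indicator {p<..x} s
        = ennreal (g (F s)) * indicator {F p..v} (F s)"
      \<comment> \<open>Off these three level sets weak and strict comparisons agree after applying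
        \<open>F\<close>, so a window for \<open>s\<close> is a window for
        \<open>F s\<close>.\<close>
      using F_neq_AE[of "F p"] F_neq_AE[of "F x"] F_neq_AE[of "1 - w * q"]
    proof eventually_elim
      case (elim s)
      have "p < s \<longleftrightarrow> F p \<le> F s"
        using elim F_mono[of p s] F_mono[of s p] by (cases "p < s") auto
      moreover have "s \<le> x \<longleftrightarrow> F s \<le> F x"
        using elim F_mono[of x s] F_mono[of s x] by (cases "s \<le> x") auto
      ultimately show ?case
        using elim by (auto simp: v_def split: split_indicator)
    qed
  qed
  also have "\<dots> = (\<integral>\<^sup>+u\<in>{0..1}. ennreal (g u) * indicator {F p..v} u \<partial>lborel)"
    by (rule nn_integral_cdf_transform) simp
  also have "\<dots> = (\<integral>\<^sup>+u. ennreal (g u) * indicator {F p..v} u \<partial>lborel)"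
    using v cdf_nonneg[of p] by (intro nn_integral_cong) (auto split: split_indicator)
  also have "\<dots> = ennreal ((q / (1 - v)) powr c - (q / (1 - F p)) powr c)"
  proof (rule nn_integral_FTC_Icc)
    fix u assume u: "u \<in> {F p..v}"
    then have u1: "u < 1" using v by auto
    show "0 \<le> g u" unfolding g_def using u1 c by auto
    have "((\<lambda>u. (q / (1 - u)) powr c) has_real_derivative
        c * (q / (1 - u)) powr (c - 1) * (q / ((1 - u) * (1 - u)))) (at u)"
      using u1 q by (auto intro!: derivative_eq_intros simp: field_simps)
    moreover have "c * (q / (1 - u)) powr (c - 1) * (q / ((1 - u) * (1 - u))) = g u"
    proof -
      define t where "t = 1 - u"
      have t: "0 < t" using u1 by (simp add: t_def)
      show ?thesis
        unfolding g_def t_def[symmetric] using t q by (simp add: powr_diff field_simps)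
    qed
    ultimately show "((\<lambda>u. (q / (1 - u)) powr c) has_real_derivative g u) (at u)"
      by simp
  qed (use v in auto)
  also have "(q / (1 - v)) powr c = max ((1 - F x) / q) w powr (- c)"
  proof -
    have "max ((1 - F x) / q) w = (1 - v) / q"
      using q by (auto simp: v_def max_def min_def field_simps)
    then show ?thesis
      using q v by (simp add: powr_minus powr_divide)
  qed
  finally show ?thesis
    using q unfolding q_def g_def by simp
qed

end

section \<open>Uniqueness of measures on product spaces\<close>

lemma sets_PiM_upper_boxes:
  assumes "finite I"
  shows "sets (PiM I (\<lambda>_. borel :: real measure))
    = sigma_sets (PiE I (\<lambda>_. UNIV)) (range (\<lambda>a. PiE I (\<lambda>i. {a i<..})))" (is "_ = sigma_sets ?\<Omega> ?E")
proof
  have E: "?E \<subseteq> Pow ?\<Omega>" by auto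
  let ?N = "sigma ?\<Omega> ?E"
  have N: "space ?N = ?\<Omega>" "sets ?N = sigma_sets ?\<Omega> ?E" using E by auto
  show "sets (PiM I (\<lambda>_. borel)) \<subseteq> sigma_sets ?\<Omega> ?E"
    unfolding N(2)[symmetric]
  proof (rule sets_PiM_in_sets)
    fix i A assume i: "i \<in> I" and A: "A \<in> sets (borel :: real measure)"
    have "(\<lambda>x. x i) \<in> borel_measurable ?N"
    proof (rule borel_measurableI_greater)
      fix y :: real
      \<comment> \<open>The remaining sides start at \<open>- n\<close>, so that the boxes increase
        to the half-space \<open>y < x i\<close>.\<close>
      define B where "B n = PiE I (\<lambda>j. {(if j = i then y else - real n)<..})" for n
      have "{x \<in> space ?N. y < x i} = (\<Union>n. B n)"
      proof safe
        fix x assume x: "x \<in> space ?N" "y < x i"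
        obtain n where n: "Max ((\<lambda>j. - x j) ` I) < real n"
          using reals_Archimedean2 by blast
        have "- x j < real n" if "j \<in> I" for j
          using n that assms i by (subst (asm) Max_less_iff) auto
        then show "x \<in> (\<Union>n. B n)"
          using x i N by (auto simp: B_def PiE_iff intro!: exI[of _ n]) (meson minus_less_iff)+
      next
        fix x n assume "x \<in> B n"
        then show "x \<in> space ?N" "y < x i"
          using i N by (auto simp: B_def PiE_iff dest!: bspec[of _ _ i])
      qed
      moreover have "B n \<in> sets ?N" for n
        unfolding B_def N by (intro sigma_sets.Basic) auto
      ultimately show "{x \<in> space ?N. y < x i} \<in> sets ?N"
        by auto
    qed
    then show "{x \<in> space ?N. x i \<in> A} \<in> sets ?N"
      using A measurable_sets[of "\<lambda>x. x i" ?N borel A] by (simp add: vimage_def Int_def conj_commute)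
  qed (simp add: N)
  show "sigma_sets ?\<Omega> ?E \<subseteq> sets (PiM I (\<lambda>_. borel))"
  proof -
    have "?E \<subseteq> sets (PiM I (\<lambda>_. borel))"
      using assms by (auto intro!: sets_PiM_I_finite)
    then show ?thesis
      using sets.sigma_sets_subset[of ?E "PiM I (\<lambda>_. borel :: real measure)"] by (simp add: space_PiM)
  qed
qed

text \<open>Upper boxes suit both applications: they match the conditions \<open>t < s\<close> and
  \<open>a i < X i\<close> of a predictable rectangle, and they are the joint tail events of the
  ratios. Finiteness is asked of \<open>A\<close> alone and passes to \<open>B\<close> through
  \<open>eq\<close>.\<close>

lemma measure_eqI_upper_boxes:
  fixes A B :: "('i \<Rightarrow> real) measure"
  assumes I: "finite I"
    and sets: "sets A = sets (PiM I (\<lambda>_. borel))" "sets B = sets (PiM I (\<lambda>_. borel))"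
    and eq: "\<And>a. emeasure A (PiE I (\<lambda>i. {a i<..})) = emeasure B (PiE I (\<lambda>i. {a i<..}))"
    and fin: "\<And>a. emeasure A (PiE I (\<lambda>i. {a i<..})) \<noteq> \<infinity>"
  shows "A = B"
proof (rule measure_eqI_generator_eq[where E="range (\<lambda>a. PiE I (\<lambda>i. {a i<..}))"
      and \<Omega>="PiE I (\<lambda>_. UNIV)" and A="\<lambda>n. PiE I (\<lambda>i. {- real n<..})"])
  show "Int_stable (range (\<lambda>a. PiE I (\<lambda>i. {a i :: real<..})))"
  proof (rule Int_stableI_image)
    fix a b :: "'i \<Rightarrow> real"
    have "PiE I (\<lambda>i. {a i<..}) \<inter> PiE I (\<lambda>i. {b i<..}) = PiE I (\<lambda>i. {max (a i) (b i)<..})"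
      by (auto simp: PiE_iff)
    then show "\<exists>c\<in>UNIV. PiE I (\<lambda>i. {a i<..}) \<inter> PiE I (\<lambda>i. {b i<..}) = PiE I (\<lambda>i. {c i<..})"
      by (intro bexI[of _ "\<lambda>i. max (a i) (b i)"]) auto
  qed
  show "(\<Union>n. PiE I (\<lambda>i. {- real n<..})) = PiE I (\<lambda>_. UNIV)"
  proof safe
    fix x :: "'i \<Rightarrow> real" assume x: "x \<in> PiE I (\<lambda>_. UNIV)"
    obtain n where n: "Max (insert 0 ((\<lambda>j. - x j) ` I)) < real n"
      using reals_Archimedean2 by blast
    then have "- x j < real n" if "j \<in> I" for j
      using that I by (subst (asm) Max_less_iff) auto
    then show "x \<in> (\<Union>n. PiE I (\<lambda>i. {- real n<..}))"
      using x by (auto simp: PiE_iff intro!: exI[of _ n]) (meson minus_less_iff)+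
  qed auto
qed (use sets eq fin sets_PiM_upper_boxes[OF I] in auto)

section \<open>Sequential order statistics\<close>

lemma count_upto_eq_card: "count_upto r x t = card {l \<in> {1..r}. x l \<le> t}"
  by (simp add: count_upto_def sum.If_cases Int_def)

lemma count_before_eq_card: "count_before r x t = card {l \<in> {1..r}. x l < t}"
  by (simp add: count_before_def sum.If_cases Int_def)

lemma count_upto_le: "count_upto r x t \<le> r"
proof -
  have "count_upto r x t \<le> card {1..r}"
    unfolding count_upto_eq_card by (intro card_mono) auto
  then show ?thesis by simp
qed

definition simple_arrivals :: "nat \<Rightarrow> (nat \<Rightarrow> real) \<Rightarrow> bool" where
  "simple_arrivals r x \<longleftrightarrow> (\<forall>i\<in>{1..r}. 0 < x i) \<and> strict_mono_on {1..r} x"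

text \<open>An observation at or before time 0 would contradict \<open>N 0 = 0\<close>, and a tie
  would force a jump of size at least two.\<close>

lemma simple_arrivals_if_counting_path:
  assumes path: "counting_path (count_upto r x)" and sorted: "mono_on {1..r} x"
  shows "simple_arrivals r x"
proof -
  have pos: "0 < x i" if "i \<in> {1..r}" for i
    using path that unfolding counting_path_def count_upto_eq_card by (force simp: not_le[symmetric])
  have "x i < x j" if ij: "i \<in> {1..r}" "j \<in> {1..r}" "i < j" for i j
  proof (rule ccontr)
    assume "\<not> ?thesis"
    moreover have "x i \<le> x j" using ij by (intro mono_onD[OF sorted]) auto
    ultimately have eq: "x i = x j" by simp
    obtain s where s: "s \<in> {0..<x j}" "count_upto r x (x j) \<le> count_upto r x s + 1"
      using path pos[OF ij(2)] unfolding counting_path_def by blast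
    have "card ({l \<in> {1..r}. x l \<le> s} \<union> {i, j}) \<le> card {l \<in> {1..r}. x l \<le> x j}"
      using s ij eq by (intro card_mono) auto
    moreover have "card ({l \<in> {1..r}. x l \<le> s} \<union> {i, j}) = card {l \<in> {1..r}. x l \<le> s} + 2"
      using s ij eq by (subst card_Un_disjoint) auto
    ultimately show False using s(2) by (simp add: count_upto_eq_card)
  qed
  then show ?thesis
    using pos by (auto simp: simple_arrivals_def strict_mono_on_def)
qed

text \<open>This inversion turns events about single observations into events about the counting
  process, hence into members of its natural filtration.\<close>

lemma count_upto_less_iff:
  assumes "simple_arrivals r x" "i \<in> {1..r}"
  shows "count_upto r x t < i \<longleftrightarrow> t < x i"
proof
  have less: "x l < x k \<longleftrightarrow> l < k" if "l \<in> {1..r}" "k \<in> {1..r}" for l k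
    using assms(1) strict_mono_on_less[of "{1..r}" x, OF _ that] by (simp add: simple_arrivals_def)
  show "t < x i" if "count_upto r x t < i"
  proof (rule ccontr)
    assume "\<not> t < x i"
    then have "{1..i} \<subseteq> {l \<in> {1..r}. x l \<le> t}"
      using less[of i] assms(2) by (force simp: not_less)
    then have "i \<le> count_upto r x t"
      using card_mono[of "{l \<in> {1..r}. x l \<le> t}" "{1..i}"] by (simp add: count_upto_eq_card)
    with that show False by simp
  qed
  assume "t < x i"
  then have "{l \<in> {1..r}. x l \<le> t} \<subseteq> {1..<i}"
    using less[of _ i] assms(2) by force
  then have "count_upto r x t \<le> card {1..<i}"
    unfolding count_upto_eq_card by (intro card_mono) auto
  then show "count_upto r x t < i" using assms(2) by auto
qed

lemma ext0_nonneg: "\<forall>j\<in>{1..r}. 0 < \<gamma> j \<Longrightarrow> 0 \<le> ext0 r \<gamma> k"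
  by (auto simp: ext0_def less_imp_le)

lemma measurable_count_before:
  assumes [measurable]: "\<And>l. l \<in> {1..r} \<Longrightarrow> (\<lambda>z. x z l) \<in> borel_measurable M" "s \<in> borel_measurable M"
  shows "(\<lambda>z. count_before r (x z) (s z)) \<in> M \<rightarrow>\<^sub>M count_space UNIV"
proof (rule measurable_count_space_eq2_countable[THEN iffD2], intro conjI ballI)
  fix k :: nat
  have *: "(\<lambda>z. \<Sum>l = 1..r. if x z l < s z then 1 else 0 :: real) \<in> borel_measurable M"
    by (intro borel_measurable_sum) measurable
  have "(\<lambda>z. count_before r (x z) (s z)) -` {k} \<inter> space M
      = (\<lambda>z. \<Sum>l = 1..r. if x z l < s z then 1 else 0 :: real) -` {real k} \<inter> space M"
  proof -
    have "real (count_before r (x z) (s z)) = (\<Sum>l = 1..r. if x z l < s z then 1 else 0)" for z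
      by (simp add: count_before_def if_distrib cong: if_cong)
    then show ?thesis
      by (intro set_eqI) (simp only: vimage_eq Int_iff singleton_iff flip: of_nat_eq_iff[where 'a=real])
  qed
  also have "\<dots> \<in> sets M" using * by (rule measurable_sets) simp
  finally show "(\<lambda>z. count_before r (x z) (s z)) -` {k} \<inter> space M \<in> sets M" .
qed auto

text \<open>The history seen just before time \<open>s\<close>: coordinate \<open>0\<close> is the clock, the others are the observations
  stopped at \<open>s\<close>. For a box of the form \<open>{a\<^sub>0<..} \<times> \<dots> \<times> {a\<^sub>r<..}\<close> the event that the stopped history lies in
  it is almost surely a predictable rectangle, so that these boxes can replace the predictable sigma algebra.\<close>

definition stopped :: "nat \<Rightarrow> real \<Rightarrow> (nat \<Rightarrow> real) \<Rightarrow> nat \<Rightarrow> real" where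
  "stopped r s x = (\<lambda>i\<in>{0..r}. if i = 0 then s else min (x i) s)"

lemma measurable_stopped [measurable (raw)]:
  assumes [measurable]: "\<And>l. l \<in> {1..r} \<Longrightarrow> (\<lambda>z. x z l) \<in> borel_measurable M" "s \<in> borel_measurable M"
  shows "(\<lambda>z. stopped r (s z) (x z)) \<in> M \<rightarrow>\<^sub>M PiM {0..r} (\<lambda>_. borel)"
  unfolding stopped_def
proof (rule measurable_restrict)
  fix i assume "i \<in> {0..r}"
  then show "(\<lambda>z. if i = 0 then s z else min (x z i) (s z)) \<in> borel_measurable M"
    by (cases "i = 0") auto
qed

text \<open>The probability that \<open>U powr (1 / c)\<close> exceeds \<open>w\<close>, where
  \<open>U\<close> is uniform on [0, 1] and \<open>c\<close> is positive.\<close>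

definition ratio_tail :: "real \<Rightarrow> real \<Rightarrow> real" where
  "ratio_tail c w = (if w \<le> 0 then 1 else if 1 \<le> w then 0 else 1 - w powr c)"

locale sos_process = prob_space P + life: ac_lifetime \<mu>
  for P :: "'a measure" and \<mu> :: "real measure" +
  fixes r :: nat and \<gamma> :: "nat \<Rightarrow> real" and X :: "'a \<Rightarrow> nat \<Rightarrow> real"
  assumes \<gamma>_pos: "\<forall>j\<in>{1..r}. 0 < \<gamma> j"
    and sos: "sequential_order_statistics P r \<gamma> (cdf \<mu>) X"
begin

abbreviation F :: "real \<Rightarrow> real" where "F \<equiv> cdf \<mu>"

text \<open>The intensity relative to \<open>\<mu>\<close> instead of Lebesgue measure. Where
  \<open>F s = 1\<close> it is 0 by division by zero, in agreement with the hazard rate.\<close>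

definition rate :: "(nat \<Rightarrow> real) \<Rightarrow> real \<Rightarrow> real" where
  "rate x s = ext0 r \<gamma> (count_before r x s + 1) / (1 - F s)"

abbreviation N :: "real \<Rightarrow> 'a \<Rightarrow> nat" where "N t \<omega> \<equiv> count_upto r (X \<omega>) t"

abbreviation Fil :: "real \<Rightarrow> 'a measure" where "Fil \<equiv> natural_filtration P N"

lemma measurable_X: "X \<in> P \<rightarrow>\<^sub>M vec_borel r"
  using sos by (simp add: sequential_order_statistics_def)

lemma measurable_X_component [measurable]: "l \<in> {1..r} \<Longrightarrow> (\<lambda>\<omega>. X \<omega> l) \<in> borel_measurable P"
  by (rule measurable_compose[OF measurable_X]) simp

lemma rate_nonneg: "0 \<le> rate x s"
  unfolding rate_def using ext0_nonneg[OF \<gamma>_pos] life.F_le_1 by simp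

lemma measurable_rate [measurable (raw)]:
  assumes "\<And>l. l \<in> {1..r} \<Longrightarrow> (\<lambda>z. x z l) \<in> borel_measurable M" and [measurable]: "s \<in> borel_measurable M"
  shows "(\<lambda>z. rate (x z) (s z)) \<in> borel_measurable M"
proof -
  have "(\<lambda>z. ext0 r \<gamma> (count_before r (x z) (s z) + 1)) \<in> borel_measurable M"
    by (rule measurable_compose[OF measurable_count_before[OF assms]]) auto
  then show ?thesis
    unfolding rate_def by measurable
qed

lemma measurable_N: "0 \<le> t \<Longrightarrow> N t \<in> P \<rightarrow>\<^sub>M count_space UNIV"
  using sos by (simp add: sequential_order_statistics_def counting_process_def Let_def)

lemma cumulative_intensity_eq:
  "cumulative_intensity r \<gamma> F x t = (\<integral>\<^sup>+s\<in>{0..t}. ennreal (rate x s) \<partial>\<mu>)"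
proof -
  have "(\<lambda>s. ext0 r \<gamma> (count_before r x s + 1)) \<in> borel_measurable borel"
    by (rule measurable_compose[OF measurable_count_before[of r "\<lambda>_. x" borel "\<lambda>s. s"]]) auto
  then show ?thesis
    unfolding cumulative_intensity_def rate_def
    using ext0_nonneg[OF \<gamma>_pos] by (intro life.nn_integral_hazard) auto
qed

lemma simple_arrivals_AE: "AE \<omega> in P. simple_arrivals r (X \<omega>)"
proof -
  have "AE \<omega> in P. mono_on {1..r} (X \<omega>)" "AE \<omega> in P. counting_path (\<lambda>t. N t \<omega>)"
    using sos by (auto simp: sequential_order_statistics_def counting_process_def Let_def)
  then show ?thesis
    by eventually_elim (rule simple_arrivals_if_counting_path)
qed

section \<open>From the martingale property to integrals over the stopped history\<close>

lemma subalgebra_Fil: "subalgebra P (Fil t)"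
proof -
  have "sets (Fil t) = sigma_sets (space P) {N s -` B \<inter> space P |s B. s \<in> {0..t}}"
    unfolding natural_filtration_def by (intro sets_measure_of) auto
  also have "\<dots> \<subseteq> sets P"
    by (intro sets.sigma_sets_subset) (auto intro!: measurable_sets[OF measurable_N])
  finally show ?thesis
    by (auto simp: subalgebra_def natural_filtration_def space_measure_of_conv)
qed

text \<open>The martingale property between \<open>a\<close> and \<open>b\<close>, tested on an
  event known at time \<open>a\<close>. It is recast with nonnegative integrals so that the limits
  and the measure extension that follow require no integrability.\<close>

lemma increment_identity:
  assumes ab: "0 \<le> a" "a \<le> b" and B: "B \<in> sets (Fil a)"
  shows "(\<integral>\<^sup>+\<omega>. indicator B \<omega> * (\<Sum>l = 1..r. indicator {a<..b} (X \<omega> l)) \<partial>P)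
    = (\<integral>\<^sup>+\<omega>. (\<integral>\<^sup>+s. indicator B \<omega> * indicator {a<..b} s * ennreal (rate (X \<omega>) s) \<partial>\<mu>) \<partial>P)"
proof -
  let ?A = "\<lambda>t \<omega>. cumulative_intensity r \<gamma> F (X \<omega>) t"
  let ?Z = "\<lambda>t \<omega>. real (N t \<omega>) - enn2real (?A t \<omega>)"
  interpret sub: finite_measure_subalgebra P "Fil a"
    using subalgebra_Fil by unfold_locales
  have BP [measurable]: "B \<in> sets P"
    using B subalgebra_Fil by (auto simp: subalgebra_def)
  have mart: "martingale P Fil ?Z"
    and A: "AE \<omega> in P. \<forall>t\<ge>0. ?A t \<omega> < \<infinity>"
    using sos by (auto simp: sequential_order_statistics_def compensator_def Let_def)
  have Z: "integrable P (?Z t)" if "0 \<le> t" for t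
    using mart that by (auto simp: martingale_def)
  have N: "integrable P (\<lambda>\<omega>. real (N t \<omega>))" if "0 \<le> t" for t
  proof (rule integrable_const_bound[of _ "real r"])
    show "(\<lambda>\<omega>. real (N t \<omega>)) \<in> borel_measurable P"
      by (rule measurable_compose[OF measurable_N[OF that]]) auto
  qed (simp add: count_upto_le)
  \<comment> \<open>The compensator inherits integrability: it is the bounded count minus the
    integrable martingale.\<close>
  have EA: "integrable P (\<lambda>\<omega>. enn2real (?A t \<omega>))" if "0 \<le> t" for t
    using Bochner_Integration.integrable_diff[OF N[OF that] Z[OF that]] by simp
  have b: "0 \<le> b" using ab by simp
  have int: "integrable P (\<lambda>\<omega>. indicator B \<omega> * f \<omega>)" if "integrable P f" for f :: "'a \<Rightarrow> real"
    using integrable_mult_indicator[OF BP that] by simp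
  have "(LINT \<omega>:B|P. ?Z b \<omega>) = (LINT \<omega>:B|P. real_cond_exp P (Fil a) (?Z b) \<omega>)"
    by (rule sub.real_cond_exp_intA[OF Z[OF b] B])
  also have "\<dots> = (LINT \<omega>:B|P. ?Z a \<omega>)"
  proof (rule set_lebesgue_integral_cong_AE)
    show "?Z a \<in> borel_measurable P"
      using Z[OF ab(1)] by (rule borel_measurable_integrable)
    show "real_cond_exp P (Fil a) (?Z b) \<in> borel_measurable P"
      by (rule borel_measurable_cond_exp2)
    have "AE \<omega> in P. real_cond_exp P (Fil a) (?Z b) \<omega> = ?Z a \<omega>"
      using mart[unfolded martingale_def, THEN conjunct2, rule_format, of a b] ab by simp
    then show "AE \<omega>\<in>B in P. real_cond_exp P (Fil a) (?Z b) \<omega> = ?Z a \<omega>"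
      by eventually_elim simp
  qed (rule BP)
  finally have "(\<integral>\<omega>. indicator B \<omega> * ?Z b \<omega> - indicator B \<omega> * ?Z a \<omega> \<partial>P) = 0"
    using int[OF Z[OF b]] int[OF Z[OF ab(1)]] by (simp add: set_lebesgue_integral_def)
  also have "(\<lambda>\<omega>. indicator B \<omega> * ?Z b \<omega> - indicator B \<omega> * ?Z a \<omega>)
      = (\<lambda>\<omega>. indicator B \<omega> * (real (N b \<omega>) - real (N a \<omega>))
        - indicator B \<omega> * (enn2real (?A b \<omega>) - enn2real (?A a \<omega>)))"
    by (simp add: fun_eq_iff algebra_simps)
  finally have eq: "(\<integral>\<omega>. indicator B \<omega> * (real (N b \<omega>) - real (N a \<omega>)) \<partial>P)
      = (\<integral>\<omega>. indicator B \<omega> * (enn2real (?A b \<omega>) - enn2real (?A a \<omega>)) \<partial>P)"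
    using int[OF Bochner_Integration.integrable_diff[OF N[OF b] N[OF ab(1)]]]
      int[OF Bochner_Integration.integrable_diff[OF EA[OF b] EA[OF ab(1)]]] by simp
  have N_diff: "real (N b \<omega>) - real (N a \<omega>) = (\<Sum>l = 1..r. indicator {a<..b} (X \<omega> l))" for \<omega>
    unfolding count_upto_def of_nat_sum sum_subtractf[symmetric]
    using ab by (intro sum.cong) (auto split: split_indicator)
  have A_split: "?A b \<omega> = ?A a \<omega> + (\<integral>\<^sup>+s\<in>{a<..b}. ennreal (rate (X \<omega>) s) \<partial>\<mu>)" for \<omega>
  proof -
    have "{0..b} = {0..a} \<union> {a<..b}" using ab by auto
    moreover have "(\<lambda>s. ennreal (rate (X \<omega>) s)) \<in> borel_measurable \<mu>"
      by measurable
    ultimately show ?thesis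
      unfolding cumulative_intensity_eq by (simp only:) (intro nn_integral_disjoint_pair, auto)
  qed
  \<comment> \<open>Almost sure finiteness matters here, because \<open>enn2real\<close> would turn
    an infinite value into 0 and spoil the difference.\<close>
  have A_diff: "AE \<omega> in P. 0 \<le> enn2real (?A b \<omega>) - enn2real (?A a \<omega>) \<and>
      ennreal (enn2real (?A b \<omega>) - enn2real (?A a \<omega>)) = (\<integral>\<^sup>+s\<in>{a<..b}. ennreal (rate (X \<omega>) s) \<partial>\<mu>)"
    using A
  proof eventually_elim
    case (elim \<omega>)
    then have "?A b \<omega> < \<infinity>" using b by simp
    then have fin: "?A a \<omega> < top" "(\<integral>\<^sup>+s\<in>{a<..b}. ennreal (rate (X \<omega>) s) \<partial>\<mu>) < top"
      unfolding A_split by auto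
    then show ?case
      unfolding A_split by (simp add: enn2real_plus)
  qed
  have "(\<integral>\<^sup>+\<omega>. indicator B \<omega> * (\<Sum>l = 1..r. indicator {a<..b} (X \<omega> l)) \<partial>P)
      = (\<integral>\<^sup>+\<omega>. ennreal (indicator B \<omega> * (real (N b \<omega>) - real (N a \<omega>))) \<partial>P)"
    unfolding N_diff
    by (intro nn_integral_cong) (simp add: ennreal_mult' sum_nonneg sum_ennreal[symmetric] ennreal_indicator)
  also have "\<dots> = ennreal (\<integral>\<omega>. indicator B \<omega> * (real (N b \<omega>) - real (N a \<omega>)) \<partial>P)"
    using int[OF Bochner_Integration.integrable_diff[OF N[OF b] N[OF ab(1)]]]
    by (intro nn_integral_eq_integral) (auto simp: N_diff sum_nonneg)
  also have "\<dots> = ennreal (\<integral>\<omega>. indicator B \<omega> * (enn2real (?A b \<omega>) - enn2real (?A a \<omega>)) \<partial>P)"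
    by (simp only: eq)
  also have "\<dots> = (\<integral>\<^sup>+\<omega>. ennreal (indicator B \<omega> * (enn2real (?A b \<omega>) - enn2real (?A a \<omega>))) \<partial>P)"
    using int[OF Bochner_Integration.integrable_diff[OF EA[OF b] EA[OF ab(1)]]] A_diff
    by (intro nn_integral_eq_integral[symmetric]) auto
  also have "\<dots> = (\<integral>\<^sup>+\<omega>. (\<integral>\<^sup>+s. indicator B \<omega> * indicator {a<..b} s * ennreal (rate (X \<omega>) s) \<partial>\<mu>) \<partial>P)"
    using A_diff
    by (intro nn_integral_cong_AE, eventually_elim)
       (auto simp: ennreal_mult' ennreal_indicator mult.commute split: split_indicator)
  finally show ?thesis .
qed

text \<open>Monotone convergence as the right end of the window tends to infinity; upper boxes put
  no upper bound on the clock.\<close>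

lemma tail_identity:
  assumes a: "0 \<le> a" and B: "B \<in> sets (Fil a)"
  shows "(\<integral>\<^sup>+\<omega>. indicator B \<omega> * (\<Sum>l = 1..r. indicator {a<..} (X \<omega> l)) \<partial>P)
    = (\<integral>\<^sup>+\<omega>. (\<integral>\<^sup>+s. indicator B \<omega> * indicator {a<..} s * ennreal (rate (X \<omega>) s) \<partial>\<mu>) \<partial>P)"
proof -
  have [measurable]: "B \<in> sets P"
    using B subalgebra_Fil by (auto simp: subalgebra_def)
  let ?I = "\<lambda>n. {a<..a + real n}"
  have ev: "\<forall>\<^sub>F n in sequentially. indicator (?I n) s = (indicator {a<..} s :: ennreal)" for s
  proof -
    obtain m :: nat where "s - a < real m" using reals_Archimedean2 by blast
    then show ?thesis
      by (intro eventually_sequentiallyI[of m]) (auto split: split_indicator)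
  qed
  have mono: "indicator (?I m) s \<le> (indicator (?I n) s :: ennreal)" if "m \<le> n" for m n s
    using that by (auto split: split_indicator)
  have 1: "(\<lambda>n. \<integral>\<^sup>+\<omega>. indicator B \<omega> * (\<Sum>l = 1..r. indicator (?I n) (X \<omega> l)) \<partial>P)
      \<longlonglongrightarrow> (\<integral>\<^sup>+\<omega>. indicator B \<omega> * (\<Sum>l = 1..r. indicator {a<..} (X \<omega> l)) \<partial>P)"
  proof (rule nn_integral_LIMSEQ)
    show "incseq (\<lambda>n \<omega>. indicator B \<omega> * (\<Sum>l = 1..r. indicator (?I n) (X \<omega> l)) :: ennreal)"
      by (auto simp: incseq_def le_fun_def intro!: mult_left_mono sum_mono mono)
    show "(\<lambda>n. indicator B \<omega> * (\<Sum>l = 1..r. indicator (?I n) (X \<omega> l)))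
        \<longlonglongrightarrow> (indicator B \<omega> * (\<Sum>l = 1..r. indicator {a<..} (X \<omega> l)) :: ennreal)" for \<omega>
      by (cases "\<omega> \<in> B") (simp_all, intro tendsto_sum tendsto_eventually ev)
  qed measurable
  have "(\<lambda>n. \<integral>\<^sup>+s. indicator B \<omega> * indicator (?I n) s * ennreal (rate (X \<omega>) s) \<partial>\<mu>)
      \<longlonglongrightarrow> (\<integral>\<^sup>+s. indicator B \<omega> * indicator {a<..} s * ennreal (rate (X \<omega>) s) \<partial>\<mu>)" for \<omega>
  proof (rule nn_integral_LIMSEQ)
    show "(\<lambda>n. indicator B \<omega> * indicator (?I n) s * ennreal (rate (X \<omega>) s))
        \<longlonglongrightarrow> indicator B \<omega> * indicator {a<..} s * ennreal (rate (X \<omega>) s)" for s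
      by (rule tendsto_eventually, rule eventually_mono[OF ev[of s]]) simp
  qed (auto simp: incseq_def le_fun_def intro!: mult_left_mono mult_right_mono mono)
  then have 2: "(\<lambda>n. \<integral>\<^sup>+\<omega>. (\<integral>\<^sup>+s. indicator B \<omega> * indicator (?I n) s * ennreal (rate (X \<omega>) s) \<partial>\<mu>) \<partial>P)
      \<longlonglongrightarrow> (\<integral>\<^sup>+\<omega>. (\<integral>\<^sup>+s. indicator B \<omega> * indicator {a<..} s * ennreal (rate (X \<omega>) s) \<partial>\<mu>) \<partial>P)"
    by (rule nn_integral_LIMSEQ[rotated 2])
       (auto simp: incseq_def le_fun_def intro!: nn_integral_mono mult_left_mono mult_right_mono mono)
  have "(\<integral>\<^sup>+\<omega>. indicator B \<omega> * (\<Sum>l = 1..r. indicator (?I n) (X \<omega> l)) \<partial>P)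
      = (\<integral>\<^sup>+\<omega>. (\<integral>\<^sup>+s. indicator B \<omega> * indicator (?I n) s * ennreal (rate (X \<omega>) s) \<partial>\<mu>) \<partial>P)" for n
    using a by (intro increment_identity B) auto
  from LIMSEQ_unique[OF 1[unfolded this] 2] show ?thesis .
qed

text \<open>A Campbell formula: summing \<open>\<Psi>\<close> over the jump times has the same mean
  as integrating it against the intensity. Both sides are integrals of \<open>\<Psi>\<close> with
  respect to measures on the space of histories, \<open>m1\<close> and \<open>m2\<close>, so it is
  enough to compare these on upper boxes.\<close>

lemma marked_point_identity:
  assumes [measurable]: "\<Psi> \<in> borel_measurable (PiM {0..r} (\<lambda>_. borel :: real measure))"
  shows "(\<Sum>l = 1..r. \<integral>\<^sup>+\<omega>. \<Psi> (stopped r (X \<omega> l) (X \<omega>)) \<partial>P)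
    = (\<integral>\<^sup>+\<omega>. (\<integral>\<^sup>+s. \<Psi> (stopped r s (X \<omega>)) * ennreal (rate (X \<omega>) s) \<partial>\<mu>) \<partial>P)"
proof -
  interpret pair_sigma_finite P \<mu> ..
  interpret C: pair_sigma_finite "count_space {1..r}" P
    by (intro pair_sigma_finite.intro sigma_finite_measure_count_space_finite
        prob_space_imp_sigma_finite prob_space_axioms) simp
  let ?K = "PiM {0..r} (\<lambda>_. borel :: real measure)"
  define m1 where "m1 = distr (count_space {1..r} \<Otimes>\<^sub>M P) ?K (\<lambda>(l, \<omega>). stopped r (X \<omega> l) (X \<omega>))"
  define m2 where "m2 = distr (density (P \<Otimes>\<^sub>M \<mu>) (\<lambda>(\<omega>, s). ennreal (rate (X \<omega>) s))) ?K (\<lambda>(\<omega>, s). stopped r s (X \<omega>))"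
  have meas1 [measurable]: "(\<lambda>(l, \<omega>). stopped r (X \<omega> l) (X \<omega>)) \<in> count_space {1..r} \<Otimes>\<^sub>M P \<rightarrow>\<^sub>M ?K"
    by (rule measurable_pair_measure_countable1) auto
  have meas2 [measurable]: "(\<lambda>(\<omega>, s). stopped r s (X \<omega>)) \<in> P \<Otimes>\<^sub>M \<mu> \<rightarrow>\<^sub>M ?K"
    by measurable
  have [measurable]: "(\<lambda>(\<omega>, s). rate (X \<omega>) s) \<in> borel_measurable (P \<Otimes>\<^sub>M \<mu>)"
    by measurable
  have m1: "(\<integral>\<^sup>+k. f k \<partial>m1) = (\<Sum>l = 1..r. \<integral>\<^sup>+\<omega>. f (stopped r (X \<omega> l) (X \<omega>)) \<partial>P)"
    if [measurable]: "f \<in> borel_measurable ?K" for f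
  proof -
    have "(\<integral>\<^sup>+k. f k \<partial>m1) = (\<integral>\<^sup>+z. f (case z of (l, \<omega>) \<Rightarrow> stopped r (X \<omega> l) (X \<omega>)) \<partial>(count_space {1..r} \<Otimes>\<^sub>M P))"
      unfolding m1_def by (rule nn_integral_distr[OF meas1]) simp
    also have "\<dots> = (\<integral>\<^sup>+l. (\<integral>\<^sup>+\<omega>. f (stopped r (X \<omega> l) (X \<omega>)) \<partial>P) \<partial>count_space {1..r})"
      using sigma_finite_measure.nn_integral_fst[OF prob_space_imp_sigma_finite[OF prob_space_axioms]
          measurable_compose[OF meas1 that]] by simp
    finally show ?thesis by (simp add: nn_integral_count_space_finite)
  qed
  have m2: "(\<integral>\<^sup>+k. f k \<partial>m2) = (\<integral>\<^sup>+\<omega>. (\<integral>\<^sup>+s. f (stopped r s (X \<omega>)) * ennreal (rate (X \<omega>) s) \<partial>\<mu>) \<partial>P)"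
    if [measurable]: "f \<in> borel_measurable ?K" for f
  proof -
    have "(\<integral>\<^sup>+k. f k \<partial>m2) = (\<integral>\<^sup>+z. (case z of (\<omega>, s) \<Rightarrow> ennreal (rate (X \<omega>) s)) * f (case z of (\<omega>, s) \<Rightarrow> stopped r s (X \<omega>)) \<partial>(P \<Otimes>\<^sub>M \<mu>))"
      unfolding m2_def by (subst nn_integral_distr) (use meas2 in \<open>simp_all add: nn_integral_density\<close>)
    also have "\<dots> = (\<integral>\<^sup>+\<omega>. (\<integral>\<^sup>+s. f (stopped r s (X \<omega>)) * ennreal (rate (X \<omega>) s) \<partial>\<mu>) \<partial>P)"
      using life.nn_integral_fst[of "\<lambda>z. (case z of (\<omega>, s) \<Rightarrow> ennreal (rate (X \<omega>) s)) * f (case z of (\<omega>, s) \<Rightarrow> stopped r s (X \<omega>))" P]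
        measurable_compose[OF meas2 that]
      by (simp add: mult.commute)
    finally show ?thesis .
  qed
  have "m1 = m2"
  proof (rule measure_eqI_upper_boxes)
    fix a :: "nat \<Rightarrow> real"
    let ?box = "PiE {0..r} (\<lambda>i. {a i<..})"
    have box [measurable]: "?box \<in> sets ?K" by (intro sets_PiM_I_finite) auto
    \<comment> \<open>\<open>min (X i) s\<close> exceeds \<open>a i\<close> iff both
      \<open>X i\<close> and \<open>s\<close> do. Hence the clock has to pass every
      \<open>a i\<close>, and by then it is known whether each \<open>X i\<close> exceeds
      \<open>a i\<close>.\<close>
    define t where "t = Max (insert 0 (a ` {0..r}))"
    have t: "0 \<le> t" "\<And>i. i \<in> {0..r} \<Longrightarrow> a i \<le> t"
      unfolding t_def by (intro Max_ge; force)+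
    have t_less: "t < s \<longleftrightarrow> 0 < s \<and> (\<forall>i\<in>{0..r}. a i < s)" for s
      unfolding t_def by (subst Max_less_iff) auto
    \<comment> \<open>The filtration has only times from 0 on, hence the \<open>max\<close>. Nothing
      is lost for negative \<open>a i\<close>, since observations are almost surely
      positive.\<close>
    define B where "B = {\<omega> \<in> space P. \<forall>i\<in>{1..r}. N (max 0 (a i)) \<omega> < i}"
    have B: "B \<in> sets (Fil t)"
    proof -
      have sp: "space (Fil t) = space P"
        by (simp add: natural_filtration_def space_measure_of_conv)
      have "{\<omega> \<in> space (Fil t). N (max 0 (a i)) \<omega> < i} \<in> sets (Fil t)" if "i \<in> {1..r}" for i
      proof -
        have "{\<omega> \<in> space (Fil t). N (max 0 (a i)) \<omega> < i} = N (max 0 (a i)) -` {..<i} \<inter> space P"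
          by (auto simp: sp)
        also have "\<dots> \<in> sets (Fil t)"
          unfolding natural_filtration_def using t that
          by (subst sets_measure_of) (auto intro!: sigma_sets.Basic exI[of _ "max 0 (a i)"])
        finally show ?thesis .
      qed
      then have "{\<omega> \<in> space (Fil t). \<forall>i\<in>{1..r}. N (max 0 (a i)) \<omega> < i} \<in> sets (Fil t)"
        by (intro sets.sets_Collect_finite_All) auto
      then show ?thesis by (simp add: B_def sp)
    qed
    have [measurable]: "B \<in> sets P"
      using B subalgebra_Fil by (auto simp: subalgebra_def)
    have ind: "indicator ?box (stopped r s (X \<omega>)) = indicator B \<omega> * (indicator {t<..} s :: ennreal)"
      if "simple_arrivals r (X \<omega>)" "0 < s" "\<omega> \<in> space P" for \<omega> s
    proof -
      have "\<omega> \<in> B \<longleftrightarrow> (\<forall>i\<in>{1..r}. a i < X \<omega> i)"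
        using that by (auto simp: B_def count_upto_less_iff simple_arrivals_def)
      moreover have "{0..r} = insert 0 {1..r}" by auto
      ultimately have "stopped r s (X \<omega>) \<in> ?box \<longleftrightarrow> \<omega> \<in> B \<and> t < s"
        unfolding t_less using that(2) by (auto simp: stopped_def PiE_iff)
      then show ?thesis by (auto split: split_indicator)
    qed
    have "emeasure m1 ?box = (\<Sum>l = 1..r. \<integral>\<^sup>+\<omega>. indicator ?box (stopped r (X \<omega> l) (X \<omega>)) \<partial>P)"
      by (subst m1[symmetric]) (auto simp: m1_def)
    also have "\<dots> = (\<Sum>l = 1..r. \<integral>\<^sup>+\<omega>. indicator B \<omega> * indicator {t<..} (X \<omega> l) \<partial>P)"
    proof (intro sum.cong nn_integral_cong_AE refl)
      fix l assume l: "l \<in> {1..r}"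
      show "AE \<omega> in P. indicator ?box (stopped r (X \<omega> l) (X \<omega>)) = indicator B \<omega> * (indicator {t<..} (X \<omega> l) :: ennreal)"
        using simple_arrivals_AE AE_space
      proof eventually_elim
        case (elim \<omega>)
        then have "0 < X \<omega> l" using l by (auto simp: simple_arrivals_def)
        with elim show ?case by (intro ind) auto
      qed
    qed
    also have "\<dots> = (\<integral>\<^sup>+\<omega>. indicator B \<omega> * (\<Sum>l = 1..r. indicator {t<..} (X \<omega> l)) \<partial>P)"
      unfolding sum_distrib_left by (rule nn_integral_sum[symmetric]) simp
    finally have e1: "emeasure m1 ?box = \<dots>" .
    have "emeasure m2 ?box = (\<integral>\<^sup>+\<omega>. (\<integral>\<^sup>+s. indicator ?box (stopped r s (X \<omega>)) * ennreal (rate (X \<omega>) s) \<partial>\<mu>) \<partial>P)"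
      by (subst m2[symmetric]) (auto simp: m2_def)
    also have "\<dots> = (\<integral>\<^sup>+\<omega>. (\<integral>\<^sup>+s. indicator B \<omega> * indicator {t<..} s * ennreal (rate (X \<omega>) s) \<partial>\<mu>) \<partial>P)"
    proof (rule nn_integral_cong_AE)
      show "AE \<omega> in P. (\<integral>\<^sup>+s. indicator ?box (stopped r s (X \<omega>)) * ennreal (rate (X \<omega>) s) \<partial>\<mu>)
          = (\<integral>\<^sup>+s. indicator B \<omega> * indicator {t<..} s * ennreal (rate (X \<omega>) s) \<partial>\<mu>)"
        using simple_arrivals_AE AE_space
      proof eventually_elim
        case (elim \<omega>)
        show ?case
          by (intro nn_integral_cong_AE, rule eventually_mono[OF life.AE_pos]) (simp add: ind elim)
      qed
    qed
    finally show "emeasure m1 ?box = emeasure m2 ?box"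
      unfolding e1 by (simp only: tail_identity[OF t(1) B])
    \<comment> \<open>There are at most \<open>r\<close> jumps, which bounds the mass.\<close>
    have "emeasure m1 ?box \<le> (\<integral>\<^sup>+\<omega>. of_nat r \<partial>P)"
      unfolding e1
    proof (rule nn_integral_mono)
      fix \<omega>
      have "(\<Sum>l = 1..r. indicator {t<..} (X \<omega> l)) \<le> (of_nat (card {1..r}) * 1 :: ennreal)"
        by (rule sum_bounded_above) (auto split: split_indicator)
      then show "indicator B \<omega> * (\<Sum>l = 1..r. indicator {t<..} (X \<omega> l)) \<le> (of_nat r :: ennreal)"
        by (auto split: split_indicator)
    qed
    also have "\<dots> < top"
      by (simp add: emeasure_space_1 of_nat_less_top)
    finally show "emeasure m1 ?box \<noteq> \<infinity>" by simp
  qed (auto simp: m1_def m2_def)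
  with m1[OF assms] m2[OF assms] show ?thesis by simp
qed

text \<open>Choose \<open>\<Psi>\<close> to read only the clock. The intensity side vanishes because
  level sets of \<open>F\<close> are null for \<open>\<mu>\<close>, so no jump time falls into such
  a set.\<close>

lemma F_X_neq_AE: "AE \<omega> in P. \<forall>l\<in>{1..r}. F (X \<omega> l) \<noteq> c"
proof -
  let ?\<Psi> = "\<lambda>k :: nat \<Rightarrow> real. indicator {s. F s = c} (k 0) :: ennreal"
  have "(\<Sum>l = 1..r. \<integral>\<^sup>+\<omega>. ?\<Psi> (stopped r (X \<omega> l) (X \<omega>)) \<partial>P)
      = (\<integral>\<^sup>+\<omega>. (\<integral>\<^sup>+s. ?\<Psi> (stopped r s (X \<omega>)) * ennreal (rate (X \<omega>) s) \<partial>\<mu>) \<partial>P)"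
    by (rule marked_point_identity) measurable
  also have "\<dots> = (\<integral>\<^sup>+\<omega>. (\<integral>\<^sup>+s. 0 \<partial>\<mu>) \<partial>P)"
    by (intro nn_integral_cong nn_integral_cong_AE, rule eventually_mono[OF life.F_neq_AE[of c]])
       (simp add: stopped_def)
  finally have *: "(\<integral>\<^sup>+\<omega>. indicator {s. F s = c} (X \<omega> l) \<partial>P) = (0::ennreal)" if "l \<in> {1..r}" for l
    using that by (simp add: stopped_def)
  have "AE \<omega> in P. F (X \<omega> l) \<noteq> c" if l[simp]: "l \<in> {1..r}" for l
  proof -
    have "(\<lambda>\<omega>. indicator {s. F s = c} (X \<omega> l) :: ennreal) \<in> borel_measurable P"
      using measurable_X_component[OF l] by measurable
    then have "AE \<omega> in P. indicator {s. F s = c} (X \<omega> l) = (0::ennreal)"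
      using *[OF l] by (subst (asm) nn_integral_0_iff_AE) auto
    then show ?thesis by eventually_elim (auto split: split_indicator_asm)
  qed
  then show ?thesis by (intro AE_finite_allI) auto
qed

lemma F_X_less_1_AE: "AE \<omega> in P. \<forall>l\<in>{1..r}. F (X \<omega> l) < 1"
  using F_X_neq_AE[of 1] by eventually_elim (use life.F_le_1 in \<open>auto simp: less_le\<close>)

section \<open>Law of the survival ratios\<close>

text \<open>The case \<open>j = 1\<close> is separate because \<open>prev\<close> is also applied to
  stopped histories, whose coordinate 0 holds the clock.\<close>

definition prev :: "nat \<Rightarrow> (nat \<Rightarrow> real) \<Rightarrow> real" where
  "prev j x = (if j = 1 then 0 else x (j - 1))"

definition ratio :: "nat \<Rightarrow> (nat \<Rightarrow> real) \<Rightarrow> real" where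
  "ratio j x = (1 - F (x j)) / (1 - F (prev j x))"

lemma measurable_prev:
  assumes "\<And>l. l \<in> {1..r} \<Longrightarrow> (\<lambda>z. x z l) \<in> borel_measurable M" "j \<in> {1..r}"
  shows "(\<lambda>z. prev j (x z)) \<in> borel_measurable M"
  unfolding prev_def using assms(2) by (cases "j = 1") (auto intro!: assms(1))

lemma measurable_ratio:
  assumes "\<And>l. l \<in> {1..r} \<Longrightarrow> (\<lambda>z. x z l) \<in> borel_measurable M" "j \<in> {1..r}"
  shows "(\<lambda>z. ratio j (x z)) \<in> borel_measurable M"
  unfolding ratio_def using measurable_prev[OF assms] assms(1)[OF assms(2)] by measurable

lemma ratio_cong: "(\<And>i. i \<in> {1..j} \<Longrightarrow> x i = y i) \<Longrightarrow> 1 \<le> j \<Longrightarrow> ratio j x = ratio j y"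
  by (auto simp: ratio_def prev_def)

lemma ratio_bounds_AE: "AE \<omega> in P. \<forall>j\<in>{1..r}. 0 < ratio j (X \<omega>) \<and> ratio j (X \<omega>) \<le> 1"
  using simple_arrivals_AE F_X_less_1_AE
proof eventually_elim
  case (elim \<omega>)
  show ?case
  proof
    fix j assume j: "j \<in> {1..r}"
    have "prev j (X \<omega>) \<le> X \<omega> j"
      using elim(1) j by (auto simp: prev_def simple_arrivals_def strict_mono_on_def less_imp_le)
    then have "F (prev j (X \<omega>)) \<le> F (X \<omega> j)" by (rule life.F_mono)
    moreover have "F (X \<omega> j) < 1" using elim(2) j by blast
    ultimately show "0 < ratio j (X \<omega>) \<and> ratio j (X \<omega>) \<le> 1"
      by (auto simp: ratio_def field_simps)
  qed
qed

text \<open>Write \<open>R\<close> for the ratio with index \<open>j\<close> and \<open>c\<close>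
  for \<open>\<gamma> j\<close>. The integrand \<open>\<Psi>\<close> has jump part
  \<open>?a\<close>, which is \<open>R powr (- c)\<close> if \<open>w < R\<close> and 0 otherwise,
  and compensator part \<open>?b - 1\<close> with \<open>?b = max R w powr (- c)\<close>. Pointwise,
  \<open>?a\<close> plus \<open>w powr (- c)\<close> times the indicator of \<open>R \<le> w\<close>
  is \<open>?b\<close>. Since the two parts have equal means on \<open>A\<close>, what remains is
  that \<open>w powr (- c)\<close> times the mass of \<open>A\<close> with \<open>R \<le> w\<close>
  is the mass of \<open>A\<close>. The event \<open>A\<close> may enter a predictable integrand
  because it is settled once observation \<open>j - 1\<close> has been made.\<close>

lemma ratio_conditional_law:
  fixes v :: "nat \<Rightarrow> real" and w :: real
  assumes j: "j \<in> {1..r}" and w: "0 < w" "w \<le> 1"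
  defines "A \<equiv> {x. \<forall>i\<in>{1..<j}. v i < ratio i x}"
  shows "(\<integral>\<^sup>+\<omega>. indicator A (X \<omega>) * indicator {..w} (ratio j (X \<omega>)) \<partial>P)
    = ennreal (w powr \<gamma> j) * (\<integral>\<^sup>+\<omega>. indicator A (X \<omega>) \<partial>P)"
proof -
  define c where "c = \<gamma> j"
  have c: "0 < c" using \<gamma>_pos j by (simp add: c_def)
  have j1: "j - 1 \<in> {1..r}" if "j \<noteq> 1"
    using j that by auto
  \<comment> \<open>In the time scale \<open>u = ln ((1 - F p) / (1 - F s))\<close> this is \<open>exp (c * u)\<close> cut off at \<open>a = - ln w\<close>, chosen because
    \<open>g u - c * integral of g over [0, u]\<close> then only depends on whether \<open>u < a\<close>.\<close>
  define g where "g p s = (if w * (1 - F p) < 1 - F s then ((1 - F p) / (1 - F s)) powr c else 0)" for p s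
  \<comment> \<open>In a stopped history \<open>k j = k 0\<close> says that observation
    \<open>j\<close> has not occurred before the clock time, and \<open>prev j k < k 0\<close> that
    its predecessor has. Together they express the window from \<open>prev j\<close> (excluded) to
    \<open>X j\<close> (included).\<close>
  define \<Psi> where "\<Psi> k = indicator A k * ennreal (if prev j k < k 0 \<and> k j = k 0 then g (prev j k) (k 0) else 0)" for k
  have meas_A: "(\<lambda>z. indicator A (x z) :: ennreal) \<in> borel_measurable M"
    if x: "\<And>l. l \<in> {1..r} \<Longrightarrow> (\<lambda>z. x z l) \<in> borel_measurable M" for x and M :: "'z measure"
  proof (rule borel_measurable_indicator')
    have "{z \<in> space M. v i < ratio i (x z)} \<in> sets M" if "i \<in> {1..<j}" for i
      using measurable_ratio[OF x, where j=i] that j by (intro borel_measurable_less) auto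
    then have "{z \<in> space M. \<forall>i\<in>{1..<j}. v i < ratio i (x z)} \<in> sets M"
      by (intro sets.sets_Collect_finite_All) auto
    then show "{z \<in> space M. x z \<in> A} \<in> sets M" by (simp add: A_def)
  qed
  have \<Psi>_meas: "\<Psi> \<in> borel_measurable (PiM {0..r} (\<lambda>_. borel))"
  proof -
    let ?K = "PiM {0..r} (\<lambda>_. borel :: real measure)"
    have k: "(\<lambda>k. k i) \<in> borel_measurable ?K" if "i \<in> {0..r}" for i
      using that by measurable
    have [measurable]: "(\<lambda>k. prev j k) \<in> borel_measurable ?K"
      by (rule measurable_prev) (use j in \<open>auto intro: k\<close>)
    have [measurable]: "(\<lambda>k. k j) \<in> borel_measurable ?K" "(\<lambda>k. k 0) \<in> borel_measurable ?K"
      using j by (auto intro: k)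
    have [measurable]: "Measurable.pred ?K (\<lambda>k. k j = k 0)"
      unfolding pred_def using j by (intro borel_measurable_eq k) auto
    have A_K: "(\<lambda>k. indicator A k :: ennreal) \<in> borel_measurable ?K"
      by (rule meas_A) (auto intro: k)
    show ?thesis
      unfolding \<Psi>_def g_def by (intro borel_measurable_times_ennreal A_K) measurable
  qed
  have A_cong: "indicator A x = (indicator A y :: ennreal)" if "\<And>i. i \<in> {1..<j} \<Longrightarrow> x i = y i" for x y
    using ratio_cong[of _ x y] that by (auto simp: A_def split: split_indicator)
  have \<Psi>_stopped: "\<Psi> (stopped r s x) = indicator A x * ennreal (g (prev j x) s) * indicator {prev j x<..x j} s"
    if x: "simple_arrivals r x" and s: "0 < s" for x s
  proof -
    have st: "stopped r s x 0 = s" "\<And>i. i \<in> {1..r} \<Longrightarrow> stopped r s x i = min (x i) s"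
      by (auto simp: stopped_def)
    have st_prev: "prev j (stopped r s x) = (if j = 1 then 0 else min (prev j x) s)"
      using st(2)[OF j1] by (simp add: prev_def)
    have "prev j (stopped r s x) < s \<longleftrightarrow> prev j x < s" "stopped r s x j = s \<longleftrightarrow> s \<le> x j"
      unfolding st_prev using s st(2)[OF j] by (auto simp: prev_def)
    \<comment> \<open>Once the clock has passed observation \<open>j - 1\<close>, stopping leaves
      the first \<open>j - 1\<close> coordinates unchanged, and \<open>A\<close> depends on no
      others.\<close>
    moreover have "prev j (stopped r s x) = prev j x \<and> indicator A (stopped r s x) = (indicator A x :: ennreal)"
      if p: "prev j x < s"
    proof
      show "prev j (stopped r s x) = prev j x"
        unfolding st_prev using p by (auto simp: prev_def)
      have "x i \<le> prev j x" if "i \<in> {1..<j}" for i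
        using x j that strict_mono_on_leD[of "{1..r}" x i "j - 1"] by (auto simp: prev_def simple_arrivals_def)
      then show "indicator A (stopped r s x) = (indicator A x :: ennreal)"
        using p j by (intro A_cong) (force simp: st)
    qed
    ultimately show ?thesis
      by (auto simp: \<Psi>_def st split: split_indicator)
  qed
  \<comment> \<open>The intensity counts observations strictly before \<open>s\<close>, so it keeps
    the index \<open>j\<close> up to and including the jump time \<open>s = x j\<close>.\<close>
  have rate_eq: "rate x s = c / (1 - F s)"
    if x: "simple_arrivals r x" and s: "s \<in> {prev j x<..x j}" for x s
  proof -
    have less: "x l < x k \<longleftrightarrow> l < k" if "l \<in> {1..r}" "k \<in> {1..r}" for l k
      using x strict_mono_on_less[of "{1..r}" x, OF _ that] by (simp add: simple_arrivals_def)
    have "x l < s \<longleftrightarrow> l < j" if l: "l \<in> {1..r}" for l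
    proof (cases "l < j")
      case True
      then have "x l \<le> prev j x"
        using less[of "j - 1" l] l j by (auto simp: prev_def not_less[symmetric])
      then show ?thesis using True s by auto
    next
      case False
      then show ?thesis using less[OF l j] s by auto
    qed
    then have "{l \<in> {1..r}. x l < s} = {1..<j}" using j by auto
    then have "count_before r x s + 1 = j" using j by (simp add: count_before_eq_card)
    then show ?thesis using j by (simp add: rate_def ext0_def c_def)
  qed
  let ?R = "\<lambda>\<omega>. ratio j (X \<omega>)"
  let ?a = "\<lambda>\<omega>. if w < ?R \<omega> then ?R \<omega> powr (- c) else 0"
  let ?b = "\<lambda>\<omega>. max (?R \<omega>) w powr (- c)"
  let ?E = "\<lambda>f. \<integral>\<^sup>+\<omega>. indicator A (X \<omega>) * ennreal (f \<omega>) \<partial>P"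
  have A_meas [measurable]: "(\<lambda>\<omega>. indicator A (X \<omega>) :: ennreal) \<in> borel_measurable P"
    by (rule meas_A) measurable
  have R_meas [measurable]: "?R \<in> borel_measurable P"
    by (rule measurable_ratio) (use j in measurable)
  have prev_less: "0 \<le> prev j x" "prev j x < x j" if "simple_arrivals r x" for x
    using that j by (auto simp: prev_def simple_arrivals_def strict_mono_on_def less_imp_le)
  have "(\<Sum>l = 1..r. \<integral>\<^sup>+\<omega>. \<Psi> (stopped r (X \<omega> l) (X \<omega>)) \<partial>P) = (\<Sum>l = 1..r. if l = j then ?E ?a else 0)"
  proof (rule sum.cong[OF refl])
    fix l assume l: "l \<in> {1..r}"
    have "AE \<omega> in P. \<Psi> (stopped r (X \<omega> l) (X \<omega>)) = (if l = j then indicator A (X \<omega>) * ennreal (?a \<omega>) else 0)"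
      using simple_arrivals_AE F_X_less_1_AE
    proof eventually_elim
      case (elim \<omega>)
      let ?x = "X \<omega>" and ?p = "prev j (X \<omega>)"
      have pos: "0 < ?x l" using elim(1) l by (simp add: simple_arrivals_def)
      show ?case
      proof (cases "l = j")
        case True
        have Fx: "F (?x j) < 1" using elim(2) j by blast
        moreover have "F ?p \<le> F (?x j)"
          using prev_less(2)[OF elim(1)] by (intro life.F_mono) simp
        ultimately have "g ?p (?x j) = ?a \<omega>"
          by (auto simp: g_def ratio_def powr_minus powr_divide field_simps)
        then show ?thesis
          using True prev_less[OF elim(1)] pos by (simp add: \<Psi>_stopped[OF elim(1)])
      next
        case False
        \<comment> \<open>The window ends at observation \<open>j\<close> and begins after its
          predecessor, so it meets no other observation.\<close>
        have "?x l \<notin> {?p<..?x j}"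
        proof (cases "l < j")
          case True
          have "strict_mono_on {1..r} ?x"
            using elim(1) by (simp add: simple_arrivals_def)
          then have "?x l \<le> ?x (j - 1)"
            by (rule strict_mono_on_leD) (use True l j in auto)
          then show ?thesis
            using True l by (auto simp: prev_def)
        next
          case False
          then have "j < l" using \<open>l \<noteq> j\<close> by simp
          then have "?x j < ?x l"
            using elim(1) l j by (auto simp: simple_arrivals_def strict_mono_on_def)
          then show ?thesis by simp
        qed
        then show ?thesis
          using False by (simp add: \<Psi>_stopped[OF elim(1) pos])
      qed
    qed
    then show "(\<integral>\<^sup>+\<omega>. \<Psi> (stopped r (X \<omega> l) (X \<omega>)) \<partial>P) = (if l = j then ?E ?a else 0)"
      by (subst nn_integral_cong_AE) auto
  qed
  then have "?E ?a = (\<Sum>l = 1..r. \<integral>\<^sup>+\<omega>. \<Psi> (stopped r (X \<omega> l) (X \<omega>)) \<partial>P)"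
    using j by simp
  also have "\<dots> = (\<integral>\<^sup>+\<omega>. (\<integral>\<^sup>+s. \<Psi> (stopped r s (X \<omega>)) * ennreal (rate (X \<omega>) s) \<partial>\<mu>) \<partial>P)"
    by (rule marked_point_identity[OF \<Psi>_meas])
  also have "\<dots> = ?E (\<lambda>\<omega>. ?b \<omega> - 1)"
  proof (rule nn_integral_cong_AE)
    show "AE \<omega> in P. (\<integral>\<^sup>+s. \<Psi> (stopped r s (X \<omega>)) * ennreal (rate (X \<omega>) s) \<partial>\<mu>) = indicator A (X \<omega>) * ennreal (?b \<omega> - 1)"
      using simple_arrivals_AE F_X_less_1_AE
    proof eventually_elim
      case (elim \<omega>)
      let ?x = "X \<omega>" and ?p = "prev j (X \<omega>)"
      let ?h = "\<lambda>s. if w * (1 - F ?p) < 1 - F s then c / (1 - F s) * ((1 - F ?p) / (1 - F s)) powr c else 0"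
      have "(\<integral>\<^sup>+s. \<Psi> (stopped r s ?x) * ennreal (rate ?x s) \<partial>\<mu>)
          = (\<integral>\<^sup>+s. indicator A ?x * (ennreal (?h s) * indicator {?p<..?x j} s) \<partial>\<mu>)"
      proof (rule nn_integral_cong_AE, rule eventually_mono[OF life.AE_pos])
        fix s :: real assume s: "0 < s"
        have "ennreal (g ?p s) * ennreal (rate ?x s) = ennreal (?h s)" if "s \<in> {?p<..?x j}"
          using rate_nonneg[of ?x s] by (simp add: rate_eq[OF elim(1) that] g_def mult.commute[of _ c] flip: ennreal_mult)
        then show "\<Psi> (stopped r s ?x) * ennreal (rate ?x s) = indicator A ?x * (ennreal (?h s) * indicator {?p<..?x j} s)"
          unfolding \<Psi>_stopped[OF elim(1) s] by (cases "s \<in> {?p<..?x j}") (simp_all add: mult.assoc)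
      qed
      also have "\<dots> = indicator A ?x * (\<integral>\<^sup>+s\<in>{?p<..?x j}. ennreal (?h s) \<partial>\<mu>)"
        by (rule nn_integral_cmult) measurable
      also have "(\<integral>\<^sup>+s\<in>{?p<..?x j}. ennreal (?h s) \<partial>\<mu>) = ennreal (?b \<omega> - 1)"
        unfolding ratio_def using prev_less[OF elim(1)] elim(2) j w c
        by (intro life.nn_integral_ratio_window) auto
      finally show ?case .
    qed
  qed
  finally have eq: "?E ?a = ?E (\<lambda>\<omega>. ?b \<omega> - 1)" .
  let ?L = "\<integral>\<^sup>+\<omega>. indicator A (X \<omega>) * indicator {..w} (?R \<omega>) \<partial>P"
  let ?T = "\<integral>\<^sup>+\<omega>. indicator A (X \<omega>) \<partial>P"
  have wpos: "0 < w powr c" using w by simp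
  have "?E ?a + ennreal (w powr (- c)) * ?L = ?E ?b"
  proof -
    have "?E ?a + ennreal (w powr (- c)) * ?L
        = (\<integral>\<^sup>+\<omega>. indicator A (X \<omega>) * ennreal (?a \<omega>)
            + ennreal (w powr (- c)) * (indicator A (X \<omega>) * indicator {..w} (?R \<omega>)) \<partial>P)"
      by (simp add: nn_integral_add nn_integral_cmult)
    also have "\<dots> = ?E ?b"
      by (intro nn_integral_cong) (auto simp: max_def split: split_indicator)
    finally show ?thesis .
  qed
  \<comment> \<open>\<open>max R w \<le> 1\<close> gives \<open>?b \<ge> 1\<close>, so
    \<open>ennreal (?b - 1)\<close> is not truncated and adding 1 restores
    \<open>?b\<close>.\<close>
  also have "?E ?b = ?E (\<lambda>\<omega>. ?b \<omega> - 1) + ?T"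
  proof -
    have "?E ?b = (\<integral>\<^sup>+\<omega>. indicator A (X \<omega>) * ennreal (?b \<omega> - 1) + indicator A (X \<omega>) \<partial>P)"
    proof (rule nn_integral_cong_AE)
      show "AE \<omega> in P. indicator A (X \<omega>) * ennreal (?b \<omega>) = indicator A (X \<omega>) * ennreal (?b \<omega> - 1) + indicator A (X \<omega>)"
        using ratio_bounds_AE
      proof eventually_elim
        case (elim \<omega>)
        then have "max (?R \<omega>) w \<le> 1" using w j by auto
        then have "1 powr (- c) \<le> ?b \<omega>"
          using w c by (intro powr_mono2') auto
        then have "ennreal (?b \<omega>) = ennreal (?b \<omega> - 1) + 1"
          by (simp flip: ennreal_1 ennreal_plus)
        then show ?case by (simp add: distrib_left)
      qed
    qed
    also have "\<dots> = ?E (\<lambda>\<omega>. ?b \<omega> - 1) + ?T"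
      by (rule nn_integral_add) measurable
    finally show ?thesis .
  qed
  finally have sum_eq: "?E ?a + ennreal (w powr (- c)) * ?L = ?E ?a + ?T"
    by (simp only: eq)
  \<comment> \<open>The cutoff at \<open>w\<close> bounds the integrand. The resulting finiteness is
    what permits cancelling \<open>?E ?a\<close> in \<open>ennreal\<close>.\<close>
  have "?E ?a \<le> (\<integral>\<^sup>+\<omega>. ennreal (w powr (- c)) \<partial>P)"
  proof (rule nn_integral_mono)
    fix \<omega>
    have "?a \<omega> \<le> w powr (- c)"
      using w c by (auto intro!: powr_mono2')
    then show "indicator A (X \<omega>) * ennreal (?a \<omega>) \<le> ennreal (w powr (- c))"
      by (auto intro: ennreal_leI split: split_indicator)
  qed
  then have "?E ?a \<noteq> top"
    by (auto simp: emeasure_space_1 top_unique)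
  with sum_eq have "ennreal (w powr (- c)) * ?L = ?T"
    by (simp add: ennreal_add_left_cancel)
  then have "ennreal (w powr c) * ?T = (ennreal (w powr c) * ennreal (w powr (- c))) * ?L"
    by (simp add: mult.assoc)
  also have "ennreal (w powr c) * ennreal (w powr (- c)) = 1"
    using wpos by (simp add: powr_minus flip: ennreal_mult)
  finally show ?thesis by (simp add: c_def)
qed

definition ratio_vector :: "(nat \<Rightarrow> real) \<Rightarrow> nat \<Rightarrow> real" where
  "ratio_vector x = (\<lambda>i\<in>{1..r}. ratio i x)"

lemma measurable_ratio_X: "i \<in> {1..r} \<Longrightarrow> (\<lambda>\<omega>. ratio i (X \<omega>)) \<in> borel_measurable P"
  by (rule measurable_ratio) auto

lemma measurable_ratio_vector: "(\<lambda>\<omega>. ratio_vector (X \<omega>)) \<in> P \<rightarrow>\<^sub>M vec_borel r"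
  unfolding ratio_vector_def by (intro measurable_restrict measurable_ratio_X)

text \<open>The conditional law of each ratio does not depend on the earlier ratios, so every
  induction step contributes one factor and the ratios come out independent.\<close>

lemma prob_ratio_box:
  "j \<le> r \<Longrightarrow> prob {\<omega> \<in> space P. \<forall>i\<in>{1..j}. v i < ratio i (X \<omega>)} = (\<Prod>i = 1..j. ratio_tail (\<gamma> i) (v i))"
proof (induction j)
  case 0
  then show ?case by (simp add: prob_space)
next
  case (Suc j)
  define E where "E = {\<omega> \<in> space P. \<forall>i\<in>{1..j}. v i < ratio i (X \<omega>)}"
  define w where "w = v (Suc j)"
  let ?R = "\<lambda>\<omega>. ratio (Suc j) (X \<omega>)"
  have j: "Suc j \<in> {1..r}" using Suc.prems by simp
  have [measurable]: "?R \<in> borel_measurable P" by (rule measurable_ratio_X[OF j])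
  have [measurable]: "E \<in> events"
  proof -
    have "{\<omega> \<in> space P. v i < ratio i (X \<omega>)} \<in> events" if "i \<in> {1..j}" for i
      using measurable_ratio_X[of i] that Suc.prems by (intro borel_measurable_less) auto
    then show ?thesis
      unfolding E_def by (intro sets.sets_Collect_finite_All) auto
  qed
  have E: "prob E = (\<Prod>i = 1..j. ratio_tail (\<gamma> i) (v i))"
    using Suc by (simp add: E_def)
  have "prob {\<omega> \<in> space P. \<forall>i\<in>{1..Suc j}. v i < ratio i (X \<omega>)} = prob {\<omega> \<in> E. w < ?R \<omega>}"
    by (rule arg_cong[where f=prob]) (auto simp: E_def w_def le_Suc_eq)
  also have "\<dots> = prob E * ratio_tail (\<gamma> (Suc j)) w"
  proof -
    \<comment> \<open>The conditional law covers thresholds in (0, 1]. Outside (0, 1) the almost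
      sure bounds on the ratio decide.\<close>
    consider "w \<le> 0" | "1 \<le> w" | "0 < w" "w < 1" by linarith
    then show ?thesis
    proof cases
      case 1
      have "prob {\<omega> \<in> E. w < ?R \<omega>} = prob E"
      proof (rule finite_measure_eq_AE)
        show "AE \<omega> in P. (\<omega> \<in> {\<omega> \<in> E. w < ?R \<omega>}) = (\<omega> \<in> E)"
          using ratio_bounds_AE by eventually_elim (use j 1 in force)
      qed measurable
      then show ?thesis using 1 by (simp add: ratio_tail_def)
    next
      case 2
      have "prob {\<omega> \<in> E. w < ?R \<omega>} = prob {}"
      proof (rule finite_measure_eq_AE)
        show "AE \<omega> in P. (\<omega> \<in> {\<omega> \<in> E. w < ?R \<omega>}) = (\<omega> \<in> {})"
          using ratio_bounds_AE by eventually_elim (use j 2 in force)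
      qed measurable
      then show ?thesis using 2 by (simp add: ratio_tail_def)
    next
      case 3
      define A where "A = {x. \<forall>i\<in>{1..<Suc j}. v i < ratio i x}"
      have A: "indicator A (X \<omega>) = (indicator E \<omega> :: ennreal)" if "\<omega> \<in> space P" for \<omega>
        using that by (auto simp: A_def E_def atLeastLessThanSuc_atLeastAtMost split: split_indicator)
      have "emeasure P {\<omega> \<in> E. ?R \<omega> \<le> w} = (\<integral>\<^sup>+\<omega>. indicator {\<omega> \<in> E. ?R \<omega> \<le> w} \<omega> \<partial>P)"
        by (rule nn_integral_indicator[symmetric]) measurable
      also have "\<dots> = (\<integral>\<^sup>+\<omega>. indicator A (X \<omega>) * indicator {..w} (?R \<omega>) \<partial>P)"
        by (intro nn_integral_cong) (auto simp: A split: split_indicator)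
      also have "\<dots> = ennreal (w powr \<gamma> (Suc j)) * (\<integral>\<^sup>+\<omega>. indicator A (X \<omega>) \<partial>P)"
        unfolding A_def using 3 by (intro ratio_conditional_law[OF j]) auto
      also have "(\<integral>\<^sup>+\<omega>. indicator A (X \<omega>) \<partial>P) = (\<integral>\<^sup>+\<omega>. indicator E \<omega> \<partial>P)"
        by (intro nn_integral_cong) (simp add: A)
      also have "\<dots> = emeasure P E"
        by (rule nn_integral_indicator) measurable
      finally have le: "prob {\<omega> \<in> E. ?R \<omega> \<le> w} = w powr \<gamma> (Suc j) * prob E"
        by (simp add: emeasure_eq_measure flip: ennreal_mult)
      have "prob E = prob ({\<omega> \<in> E. ?R \<omega> \<le> w} \<union> {\<omega> \<in> E. w < ?R \<omega>})"
        by (rule arg_cong[where f=prob]) auto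
      also have "\<dots> = prob {\<omega> \<in> E. ?R \<omega> \<le> w} + prob {\<omega> \<in> E. w < ?R \<omega>}"
        by (rule finite_measure_Union) auto
      finally show ?thesis
        using 3 by (simp add: le ratio_tail_def algebra_simps)
    qed
  qed
  finally show ?case by (simp add: E w_def)
qed

text \<open>A telescoping product: \<open>F < 1\<close> keeps the denominators nonzero, and
  \<open>F 0 = 0\<close> makes the first one equal to 1.\<close>

lemma prod_ratio:
  assumes "\<forall>l\<in>{1..r}. F (x l) < 1" "j \<le> r"
  shows "(\<Prod>i = 1..j. ratio i x) = (if j = 0 then 1 else 1 - F (x j))"
  using assms(2)
proof (induction j)
  case (Suc j)
  then have "F (x j) < 1" if "j \<noteq> 0"
    using assms(1) that by auto
  then show ?case
    using Suc by (auto simp: ratio_def prev_def life.cdf_0)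
qed simp

text \<open>The point is that the map applied to the ratios does not mention
  \<open>F\<close>.\<close>

lemma distr_F_X:
  "distr P (vec_borel r) (\<lambda>\<omega>. \<lambda>j\<in>{1..r}. F (X \<omega> j))
    = distr (distr P (vec_borel r) (\<lambda>\<omega>. ratio_vector (X \<omega>))) (vec_borel r)
        (\<lambda>\<rho>. \<lambda>j\<in>{1..r}. 1 - (\<Prod>i = 1..j. \<rho> i))"
proof -
  let ?G = "\<lambda>\<rho> :: nat \<Rightarrow> real. \<lambda>j\<in>{1..r}. 1 - (\<Prod>i = 1..j. \<rho> i)"
  have G: "?G \<in> vec_borel r \<rightarrow>\<^sub>M vec_borel r"
    by (intro measurable_restrict borel_measurable_diff borel_measurable_prod borel_measurable_const
        measurable_component_singleton) auto
  have FX: "(\<lambda>\<omega>. \<lambda>j\<in>{1..r}. F (X \<omega> j)) \<in> P \<rightarrow>\<^sub>M vec_borel r"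
    by (intro measurable_restrict measurable_compose[OF measurable_X_component]) auto
  have "distr P (vec_borel r) (\<lambda>\<omega>. \<lambda>j\<in>{1..r}. F (X \<omega> j)) = distr P (vec_borel r) (?G \<circ> (\<lambda>\<omega>. ratio_vector (X \<omega>)))"
  proof (rule distr_cong_AE)
    show "AE \<omega> in P. (\<lambda>j\<in>{1..r}. F (X \<omega> j)) = (?G \<circ> (\<lambda>\<omega>. ratio_vector (X \<omega>))) \<omega>"
      using F_X_less_1_AE
    proof eventually_elim
      case (elim \<omega>)
      have "(\<Prod>i = 1..j. ratio_vector (X \<omega>) i) = 1 - F (X \<omega> j)" if "j \<in> {1..r}" for j
      proof -
        have "(\<Prod>i = 1..j. ratio_vector (X \<omega>) i) = (\<Prod>i = 1..j. ratio i (X \<omega>))"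
          using that by (intro prod.cong) (auto simp: ratio_vector_def)
        then show ?thesis
          using prod_ratio[OF elim, of j] that by simp
      qed
      then show ?case by (auto simp: fun_eq_iff restrict_def)
    qed
  qed (use FX measurable_comp[OF measurable_ratio_vector G] in auto)
  then show ?thesis
    unfolding distr_distr[OF G measurable_ratio_vector] .
qed

end

theorem law_F_X_baseline_free:
  assumes "sos_process P \<mu> r \<gamma> X" "sos_process Q \<nu> r \<gamma> Y"
  shows "distr P (vec_borel r) (\<lambda>\<omega>. \<lambda>j\<in>{1..r}. cdf \<mu> (X \<omega> j)) = distr Q (vec_borel r) (\<lambda>\<omega>. \<lambda>j\<in>{1..r}. cdf \<nu> (Y \<omega> j))"
proof -
  interpret P: sos_process P \<mu> r \<gamma> X by fact
  interpret Q: sos_process Q \<nu> r \<gamma> Y by fact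
  \<comment> \<open>Stated for an arbitrary process, to be used for both samples: the value involves
    only \<open>\<gamma>\<close>.\<close>
  have box: "emeasure (distr M (vec_borel r) (\<lambda>\<omega>. sos_process.ratio_vector \<kappa> r (Z \<omega>))) (PiE {1..r} (\<lambda>i. {a i<..}))
      = ennreal (\<Prod>i = 1..r. ratio_tail (\<gamma> i) (a i))" if "sos_process M \<kappa> r \<gamma> Z" for M :: "'c measure" and \<kappa> Z a
  proof -
    interpret sos_process M \<kappa> r \<gamma> Z by fact
    have "emeasure (distr M (vec_borel r) (\<lambda>\<omega>. ratio_vector (Z \<omega>))) (PiE {1..r} (\<lambda>i. {a i<..}))
        = emeasure M ((\<lambda>\<omega>. ratio_vector (Z \<omega>)) -` (PiE {1..r} (\<lambda>i. {a i<..})) \<inter> space M)"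
      by (intro emeasure_distr measurable_ratio_vector sets_PiM_I_finite) auto
    also have "(\<lambda>\<omega>. ratio_vector (Z \<omega>)) -` (PiE {1..r} (\<lambda>i. {a i<..})) \<inter> space M
        = {\<omega> \<in> space M. \<forall>i\<in>{1..r}. a i < ratio i (Z \<omega>)}"
      by (auto simp: ratio_vector_def PiE_iff)
    also have "emeasure M \<dots> = ennreal (\<Prod>i = 1..r. ratio_tail (\<gamma> i) (a i))"
      by (simp only: emeasure_eq_measure prob_ratio_box[OF order_refl])
    finally show ?thesis .
  qed
  have "distr P (vec_borel r) (\<lambda>\<omega>. P.ratio_vector (X \<omega>)) = distr Q (vec_borel r) (\<lambda>\<omega>. Q.ratio_vector (Y \<omega>))"
    by (rule measure_eqI_upper_boxes[of "{1..r}"])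
      (simp_all only: box[OF assms(1)] box[OF assms(2)] sets_distr finite_atLeastAtMost infinity_ennreal_def
        ennreal_neq_top not_False_eq_True)
  then show ?thesis
    by (simp only: P.distr_F_X Q.distr_F_X)
qed

section \<open>Profile likelihood\<close>

text \<open>Strict comparisons are all that \<open>count_before\<close> reads from the data, and the
  pattern ranges over the subsets of a finite set.\<close>

definition order_pattern :: "nat \<Rightarrow> nat \<Rightarrow> (nat \<Rightarrow> nat \<Rightarrow> real) \<Rightarrow> (nat \<times> nat \<times> nat \<times> nat) set" where
  "order_pattern M r x = {(k, l, i, j) \<in> {1..M} \<times> {1..r} \<times> {1..M} \<times> {1..r}. x k l < x i j}"

lemma pl_argmax_cong:
  assumes "order_pattern M r x = order_pattern M r y"
  shows "pl_argmax n r M x = pl_argmax n r M y"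
proof -
  have less: "x k l < x i j \<longleftrightarrow> y k l < y i j"
    if "k \<in> {1..M}" "l \<in> {1..r}" "i \<in> {1..M}" "j \<in> {1..r}" for k l i j
  proof -
    have "(k, l, i, j) \<in> order_pattern M r x \<longleftrightarrow> (k, l, i, j) \<in> order_pattern M r y"
      using assms by simp
    then show ?thesis using that by (simp add: order_pattern_def)
  qed
  have "count_before r (x k) (x i j) = count_before r (y k) (y i j)"
    if "k \<in> {1..M}" "i \<in> {1..M}" "j \<in> {1..r}" for k i j
    unfolding count_before_def using less that by (intro sum.cong) auto
  then have "profile_likelihood M r g x = profile_likelihood M r g y" for g
    unfolding profile_likelihood_def by (intro prod.cong arg_cong2[where f="(/)"] sum.cong refl) auto
  then show ?thesis by (simp add: pl_argmax_def)
qed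

text \<open>The target carries the discrete sigma algebra on an uncountable type. Measurability
  holds nevertheless because the set of maximizers factors through the finitely many order patterns;
  \<open>h\<close> evaluates it at a representative data matrix of each pattern.\<close>

lemma measurable_pl_argmax:
  assumes Z: "\<And>i j. i \<in> {1..M} \<Longrightarrow> j \<in> {1..r} \<Longrightarrow> (\<lambda>\<omega>. Z \<omega> i j) \<in> borel_measurable N"
  shows "(\<lambda>\<omega>. pl_argmax n r M (Z \<omega>)) \<in> N \<rightarrow>\<^sub>M count_space UNIV"
proof -
  let ?I = "{1..M} \<times> {1..r} \<times> {1..M} \<times> {1..r}"
  define h where "h p = pl_argmax n r M (SOME x. order_pattern M r x = p)" for p
  have "pl_argmax n r M x = h (order_pattern M r x)" for x
  proof -
    have "order_pattern M r (SOME y. order_pattern M r y = order_pattern M r x) = order_pattern M r x"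
      by (rule someI[where P="\<lambda>y. order_pattern M r y = order_pattern M r x"]) (rule refl)
    then show ?thesis
      unfolding h_def by (intro pl_argmax_cong) simp
  qed
  moreover have "(\<lambda>\<omega>. h (order_pattern M r (Z \<omega>))) \<in> N \<rightarrow>\<^sub>M count_space UNIV"
  proof (rule measurable_compose[where g=h])
    show "h \<in> count_space (Pow ?I) \<rightarrow>\<^sub>M count_space UNIV" by simp
    show "(\<lambda>\<omega>. order_pattern M r (Z \<omega>)) \<in> N \<rightarrow>\<^sub>M count_space (Pow ?I)"
    proof (rule measurable_count_space_eq2[THEN iffD2], simp, intro conjI ballI)
      show "(\<lambda>\<omega>. order_pattern M r (Z \<omega>)) \<in> space N \<rightarrow> Pow ?I"
        by (auto simp: order_pattern_def)
      fix p assume p: "p \<in> Pow ?I"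
      have "{\<omega> \<in> space N. (q \<in> order_pattern M r (Z \<omega>)) = (q \<in> p)} \<in> sets N" if q: "q \<in> ?I" for q
      proof -
        obtain k l i j where q_eq: "q = (k, l, i, j)" by (cases q)
        have "{\<omega> \<in> space N. Z \<omega> k l < Z \<omega> i j} \<in> sets N"
          using q unfolding q_eq by (intro borel_measurable_less Z) auto
        moreover have "{\<omega> \<in> space N. Z \<omega> k l < Z \<omega> i j} = {\<omega> \<in> space N. q \<in> order_pattern M r (Z \<omega>)}"
          using q by (auto simp: order_pattern_def q_eq)
        ultimately have lt: "{\<omega> \<in> space N. q \<in> order_pattern M r (Z \<omega>)} \<in> sets N"
          by simp
        then show ?thesis
          using sets.sets_Collect_neg[OF lt] by (cases "q \<in> p") simp_all
      qed
      then have "{\<omega> \<in> space N. \<forall>q\<in>?I. (q \<in> order_pattern M r (Z \<omega>)) = (q \<in> p)} \<in> sets N"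
        by (rule sets.sets_Collect_finite_All) simp_all
      also have "{\<omega> \<in> space N. \<forall>q\<in>?I. (q \<in> order_pattern M r (Z \<omega>)) = (q \<in> p)}
          = (\<lambda>\<omega>. order_pattern M r (Z \<omega>)) -` {p} \<inter> space N"
      proof -
        have "order_pattern M r x \<subseteq> ?I" for x by (auto simp: order_pattern_def)
        then have "(\<forall>q\<in>?I. (q \<in> order_pattern M r x) = (q \<in> p)) \<longleftrightarrow> order_pattern M r x = p" for x
          using p by blast
        then show ?thesis by auto
      qed
      finally show "(\<lambda>\<omega>. order_pattern M r (Z \<omega>)) -` {p} \<inter> space N \<in> sets N" .
    qed
  qed
  ultimately show ?thesis by simp
qed

text \<open>If \<open>F\<close> took the same value at two distinct observations, it would take this
  value at a rational between them too. Each rational excludes only a null event, and there are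
  countably many.\<close>

lemma order_pattern_transform_AE:
  assumes X: "\<And>i. i \<in> {1..M} \<Longrightarrow> sos_process P \<mu> r \<gamma> (X i)"
  shows "AE \<omega> in P. order_pattern M r (\<lambda>i. X i \<omega>) = order_pattern M r (\<lambda>i\<in>{1..M}. \<lambda>j\<in>{1..r}. cdf \<mu> (X i \<omega> j))"
proof -
  have "AE \<omega> in P. \<forall>q\<in>\<rat>. \<forall>j\<in>{1..r}. cdf \<mu> (X i \<omega> j) \<noteq> cdf \<mu> q" if "i \<in> {1..M}" for i
    unfolding AE_ball_countable[OF countable_rat] using sos_process.F_X_neq_AE[OF X[OF that]] by blast
  then have "AE \<omega> in P. \<forall>i\<in>{1..M}. \<forall>q\<in>\<rat>. \<forall>j\<in>{1..r}. cdf \<mu> (X i \<omega> j) \<noteq> cdf \<mu> q"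
    by (rule AE_finite_allI[OF finite_atLeastAtMost])
  then show ?thesis
  proof eventually_elim
    case (elim \<omega>)
    have "X k \<omega> l < X i \<omega> j \<longleftrightarrow> cdf \<mu> (X k \<omega> l) < cdf \<mu> (X i \<omega> j)"
      if kl: "k \<in> {1..M}" "l \<in> {1..r}" and ij: "i \<in> {1..M}" "j \<in> {1..r}" for k l i j
    proof -
      interpret sos_process P \<mu> r \<gamma> "X i" using X ij by blast
      show ?thesis
      proof
        assume "X k \<omega> l < X i \<omega> j"
        then obtain q where q: "q \<in> \<rat>" "X k \<omega> l < q" "q < X i \<omega> j"
          using Rats_dense_in_real by blast
        have "cdf \<mu> (X k \<omega> l) \<le> cdf \<mu> q" "cdf \<mu> q \<le> cdf \<mu> (X i \<omega> j)"
          using q by (auto intro!: life.F_mono)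
        moreover have "cdf \<mu> (X i \<omega> j) \<noteq> cdf \<mu> q"
          using elim ij q(1) by blast
        ultimately show "cdf \<mu> (X k \<omega> l) < cdf \<mu> (X i \<omega> j)" by simp
      next
        assume "cdf \<mu> (X k \<omega> l) < cdf \<mu> (X i \<omega> j)"
        then show "X k \<omega> l < X i \<omega> j"
          using life.F_mono[of "X i \<omega> j" "X k \<omega> l"] by (cases "X k \<omega> l < X i \<omega> j") auto
      qed
    qed
    then show ?case by (auto simp: order_pattern_def)
  qed
qed

text \<open>The right-hand side of the second claim sees the probability space and the baseline only
  through the laws of the transformed rows, in which form two samples can be compared.\<close>

lemma distr_pl_argmax:
  assumes "prob_space P" and M: "1 \<le> M" and lt: "ac_lifetime \<mu>" and \<gamma>: "\<forall>j\<in>{1..r}. 0 < \<gamma> j"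
    and X: "iid_sos_sample P M r \<gamma> (cdf \<mu>) X"
  shows "(\<lambda>\<omega>. pl_argmax n r M (\<lambda>i. X i \<omega>)) \<in> P \<rightarrow>\<^sub>M count_space UNIV"
    and "distr P (count_space UNIV) (\<lambda>\<omega>. pl_argmax n r M (\<lambda>i. X i \<omega>))
      = distr (PiM {1..M} (\<lambda>i. distr P (vec_borel r) (\<lambda>\<omega>. \<lambda>j\<in>{1..r}. cdf \<mu> (X i \<omega> j)))) (count_space UNIV)
          (pl_argmax n r M)"
proof -
  interpret prob_space P by fact
  interpret life: ac_lifetime \<mu> by fact
  have sos: "sos_process P \<mu> r \<gamma> (X i)" if "i \<in> {1..M}" for i
    using X that \<gamma> by (intro sos_process.intro sos_process_axioms.intro prob_space_axioms lt) (auto simp: iid_sos_sample_def)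
  show meas: "(\<lambda>\<omega>. pl_argmax n r M (\<lambda>i. X i \<omega>)) \<in> P \<rightarrow>\<^sub>M count_space UNIV"
    using sos by (intro measurable_pl_argmax sos_process.measurable_X_component)
  let ?T = "\<lambda>x. \<lambda>j\<in>{1..r}. cdf \<mu> (x j)"
  let ?U = "\<lambda>\<omega>. \<lambda>i\<in>{1..M}. ?T (X i \<omega>)"
  have T: "?T \<in> vec_borel r \<rightarrow>\<^sub>M vec_borel r"
    by (intro measurable_restrict measurable_compose[OF _ life.F_borel] measurable_component_singleton)
  have indep: "indep_vars (\<lambda>_. vec_borel r) (\<lambda>i \<omega>. ?T (X i \<omega>)) {1..M}"
    using X by (intro indep_vars_compose2[OF _ T]) (auto simp: iid_sos_sample_def)
  have TX: "(\<lambda>\<omega>. ?T (X i \<omega>)) \<in> P \<rightarrow>\<^sub>M vec_borel r" if "i \<in> {1..M}" for i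
    using sos_process.measurable_X[OF sos[OF that]] T by (rule measurable_compose)
  have U: "?U \<in> P \<rightarrow>\<^sub>M PiM {1..M} (\<lambda>_. vec_borel r)"
    by (intro measurable_restrict TX)
  have law: "distr P (PiM {1..M} (\<lambda>_. vec_borel r)) ?U = PiM {1..M} (\<lambda>i. distr P (vec_borel r) (\<lambda>\<omega>. ?T (X i \<omega>)))"
    using indep_vars_iff_distr_eq_PiM'[of "{1..M}" "\<lambda>i \<omega>. ?T (X i \<omega>)" "\<lambda>_. vec_borel r"] TX indep M by auto
  have pl: "pl_argmax n r M \<in> PiM {1..M} (\<lambda>_. vec_borel r) \<rightarrow>\<^sub>M count_space UNIV"
  proof (rule measurable_pl_argmax)
    fix i j assume i: "i \<in> {1..M}" and j: "j \<in> {1..r}"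
    have "(\<lambda>z. z i) \<in> PiM {1..M} (\<lambda>_. vec_borel r) \<rightarrow>\<^sub>M vec_borel r"
      using i by (rule measurable_component_singleton)
    then show "(\<lambda>z. z i j) \<in> borel_measurable (PiM {1..M} (\<lambda>_. vec_borel r))"
      by (rule measurable_compose[OF _ measurable_component_singleton[OF j]])
  qed
  have "distr P (count_space UNIV) (\<lambda>\<omega>. pl_argmax n r M (\<lambda>i. X i \<omega>)) = distr P (count_space UNIV) (pl_argmax n r M \<circ> ?U)"
  proof (rule distr_cong_AE)
    show "AE \<omega> in P. pl_argmax n r M (\<lambda>i. X i \<omega>) = (pl_argmax n r M \<circ> ?U) \<omega>"
    proof -
      have "AE \<omega> in P. order_pattern M r (\<lambda>i. X i \<omega>) = order_pattern M r (?U \<omega>)"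
        by (rule order_pattern_transform_AE[OF sos])
      then show ?thesis
        by eventually_elim (simp only: o_apply, rule pl_argmax_cong)
    qed
  qed (use meas measurable_comp[OF U pl] in auto)
  also have "\<dots> = distr (distr P (PiM {1..M} (\<lambda>_. vec_borel r)) ?U) (count_space UNIV) (pl_argmax n r M)"
    by (rule distr_distr[OF pl U, symmetric])
  finally show "distr P (count_space UNIV) (\<lambda>\<omega>. pl_argmax n r M (\<lambda>i. X i \<omega>))
      = distr (PiM {1..M} (\<lambda>i. distr P (vec_borel r) (\<lambda>\<omega>. ?T (X i \<omega>)))) (count_space UNIV) (pl_argmax n r M)"
    unfolding law .
qed

lemma pl_params_subset: "pl_params n r \<subseteq> space (vec_borel r)"
  by (auto simp: pl_params_def space_PiM)

theorem theorem1:
  fixes n r M :: nat and \<gamma> :: "nat \<Rightarrow> real" and F G :: "real \<Rightarrow> real"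
    and P :: "'a measure" and X :: "nat \<Rightarrow> 'a \<Rightarrow> nat \<Rightarrow> real"
    and Q :: "'b measure" and Y :: "nat \<Rightarrow> 'b \<Rightarrow> nat \<Rightarrow> real"
  assumes "1 \<le> r" and "r \<le> n" and "1 \<le> M"
    and "\<forall>j\<in>{1..r}. 0 < \<gamma> j" and "\<gamma> 1 = real n"
    and "abs_cont_lifetime_cdf F" and "abs_cont_lifetime_cdf G"
    and "prob_space P" and "iid_sos_sample P M r \<gamma> F X"
    and "prob_space Q" and "iid_sos_sample Q M r \<gamma> G Y"
  shows "equal_in_distribution (count_space UNIV)
           P (\<lambda>\<omega>. pl_argmax n r M (\<lambda>i. X i \<omega>))
           Q (\<lambda>\<omega>. pl_argmax n r M (\<lambda>i. Y i \<omega>)) \<and>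
         (\<forall>sel. argmax_selection n r sel \<longrightarrow>
            equal_in_distribution (vec_borel r)
              P (\<lambda>\<omega>. pl_estimator sel n r M (\<lambda>i. X i \<omega>))
              Q (\<lambda>\<omega>. pl_estimator sel n r M (\<lambda>i. Y i \<omega>)))"
proof -
  have lifetime: "\<exists>\<mu>. ac_lifetime \<mu> \<and> H = cdf \<mu>" if "abs_cont_lifetime_cdf H" for H
    using that by (auto simp: abs_cont_lifetime_cdf_def ac_lifetime_def ac_lifetime_axioms_def)
  obtain \<mu> where \<mu>: "ac_lifetime \<mu>" "F = cdf \<mu>"
    using lifetime[OF assms(6)] by blast
  obtain \<nu> where \<nu>: "ac_lifetime \<nu>" "G = cdf \<nu>"
    using lifetime[OF assms(7)] by blast
  let ?A = "\<lambda>\<omega>. pl_argmax n r M (\<lambda>i. X i \<omega>)" and ?B = "\<lambda>\<omega>. pl_argmax n r M (\<lambda>i. Y i \<omega>)"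
  note A = distr_pl_argmax[OF assms(8,3) \<mu>(1) assms(4,9)[unfolded \<mu>(2)], of n]
  note B = distr_pl_argmax[OF assms(10,3) \<nu>(1) assms(4,11)[unfolded \<nu>(2)], of n]
  have "distr P (vec_borel r) (\<lambda>\<omega>. \<lambda>j\<in>{1..r}. cdf \<mu> (X i \<omega> j)) = distr Q (vec_borel r) (\<lambda>\<omega>. \<lambda>j\<in>{1..r}. cdf \<nu> (Y i \<omega> j))"
    if "i \<in> {1..M}" for i
    using assms that \<mu> \<nu>
    by (intro law_F_X_baseline_free[where \<gamma>=\<gamma>] sos_process.intro sos_process_axioms.intro)
      (auto simp: iid_sos_sample_def)
  then have eq: "distr P (count_space UNIV) ?A = distr Q (count_space UNIV) ?B"
    unfolding A(2) B(2) by (intro arg_cong[where f="\<lambda>K. distr K _ _"] PiM_cong refl) auto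
  have "equal_in_distribution (vec_borel r)
      P (\<lambda>\<omega>. pl_estimator sel n r M (\<lambda>i. X i \<omega>)) Q (\<lambda>\<omega>. pl_estimator sel n r M (\<lambda>i. Y i \<omega>))"
    if sel: "argmax_selection n r sel" for sel
  proof -
    \<comment> \<open>\<open>sel\<close> is unconstrained on sets outside the parameter space,
      whereas measurability requires vectors for all arguments. The modification agrees with
      \<open>sel\<close> on every set of maximizers.\<close>
    define s where "s A = (if A \<subseteq> pl_params n r then sel A else sel {})" for A
    have s: "s \<in> count_space UNIV \<rightarrow>\<^sub>M vec_borel r"
    proof -
      have "s A \<in> space (vec_borel r)" for A
        using sel pl_params_subset[of n r] unfolding argmax_selection_def s_def
        by (cases "A = {}") (simp_all, blast)
      then show ?thesis by simp
    qed
    have est: "pl_estimator sel n r M x = s (pl_argmax n r M x)" for x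
      by (auto simp: pl_estimator_def s_def pl_argmax_def is_arg_max_def)
    have "distr P (vec_borel r) (\<lambda>\<omega>. s (?A \<omega>)) = distr Q (vec_borel r) (\<lambda>\<omega>. s (?B \<omega>))"
      using distr_distr[OF s A(1)] distr_distr[OF s B(1)] eq by (simp add: o_def)
    then show ?thesis
      unfolding equal_in_distribution_def est
      using measurable_compose[OF A(1) s] measurable_compose[OF B(1) s] by simp
  qed
  with A(1) B(1) eq show ?thesis
    by (simp add: equal_in_distribution_def)
qed

end
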